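(* Assume that, on the sector $\langle\widehat U,\widetilde U\rangle$, the functions $f_\alpha$, $\alpha=1,2$, satisfy $$\frac{\partial f_\alpha(x_i,y_j,U)}{\partial u_\alpha}\le c_\alpha(x_i,y_j),\qquad -\frac{\partial f_\alpha(x_i,y_j,U)}{\partial u_{\alpha'}}\ge 0,\qquad U\in\langle\widehat U,\widetilde U\rangle,\ (x_i,y_j)\in\overline\Omega^h,\ \alpha'\ne\alpha,\ \alpha=1,2,$$ where $c_\alpha$ are non-negative bounded functions on $\overline\Omega^h$, and where $\widetilde U=(\widetilde U_1,\widetilde U_2)$ and $\widehat U=(\widehat U_1,\widehat U_2)$ are, respectively, ordered upper and lower solutions of the nonlinear difference scheme (defined in the context). Then the upper sequence $\{\overline U^{(n)}_{\alpha,i}\}$ and the lower sequence $\{\underline U^{(n)}_{\alpha,i}\}$, $i=0,1,\dots,N_x$, $\alpha=1,2$, generated by the block Jacobi method (defined in the context) with $\overline U^{(0)}=\widetilde U$ and $\underline U^{(0)}=\widehat U$ respectively, converge monotonically, respectively, from above to a maximal solution $\overline U$ and from below to a minimal solution $\underline U$ of the nonlinear difference scheme, such that for all $n\ge1$ $$\underline U^{(n-1)}_{\alpha,i}\le\underline U^{(n)}_{\alpha,i}\le\underline U_{\alpha,i}\le\overline U_{\alpha,i}\le\overline U^{(n)}_{\alpha,i}\le\overline U^{(n-1)}_{\alpha,i},\qquad i=0,1,\dots,N_x,\ \alpha=1,2.$$ If $S=(S_1,S_2)$ is any other solution of the nonlinear difference scheme in $\langle\widehat U,\widetilde U\rangle$,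 then $\underline U\le S\le\overline U$ in $\overline\Omega^h$.
   Context: Let $\omega=(0,1)\times(0,1)$, let $\varepsilon_1,\varepsilon_2>0$ be constants, and let $v_\alpha(x,y)\ge0$ on $\overline\omega$, $f_\alpha(x,y,u)$ with $u=(u_1,u_2)$, and $g=(g_1,g_2)$ (boundary data), $\alpha=1,2$, be smooth functions. All inequalities between vectors, vector functions and matrices are understood componentwise (entrywise). Mesh: $\overline\Omega^h=\{(x_i,y_j):0\le i\le N_x,\ 0\le j\le N_y\}$ with $x_i=ih_x$, $y_j=jh_y$, $h_x=1/N_x$, $h_y=1/N_y$; $\Omega^h$ is the set of interior mesh points ($1\le i\le N_x-1$, $1\le j\le N_y-1$) and $\partial\Omega^h=\overline\Omega^h\setminus\Omega^h$. For a mesh function $U=(U_1,U_2)$ put $U_{\alpha,ij}=U_\alpha(x_i,y_j)$. For an interior mesh point define $$\mathcal L_{\alpha,ij}U_\alpha(x_i,y_j)=-\varepsilon_\alpha\left(\frac{U_{\alpha,i-1,j}-2U_{\alpha,ij}+U_{\alpha,i+1,j}}{h_x^2}+\frac{U_{\alpha,i,j-1}-2U_{\alpha,ij}+U_{\alpha,i,j+1}}{h_y^2}\right)+v_\alpha(x_i,y_j)\left(\frac{U_{\alpha,ij}-U_{\alpha,i-1,j}}{h_x}+\frac{U_{\alpha,ij}-U_{\alpha,i,j-1}}{h_y}\right).$$ The nonlinear difference scheme is $$\mathcal L_{\alpha,ij}U_\alpha(x_i,y_j)+f_\alpha(x_i,y_j,U)=0,\ (x_i,y_j)\in\Omega^h,\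 \alpha=1,2;\qquad U(x_i,y_j)=g(x_i,y_j),\ (x_i,y_j)\in\partial\Omega^h.$$ Mesh functions $\widetilde U=(\widetilde U_1,\widetilde U_2)$ and $\widehat U=(\widehat U_1,\widehat U_2)$ are ordered upper and lower solutions of this scheme if $\widetilde U\ge\widehat U$ on $\overline\Omega^h$; $\mathcal L_{\alpha,ij}\widetilde U_\alpha(x_i,y_j)+f_\alpha(x_i,y_j,\widetilde U)\ge0$ and $\mathcal L_{\alpha,ij}\widehat U_\alpha(x_i,y_j)+f_\alpha(x_i,y_j,\widehat U)\le0$ on $\Omega^h$ for $\alpha=1,2$; and $\widehat U\le g\le\widetilde U$ on $\partial\Omega^h$. The sector is $\langle\widehat U,\widetilde U\rangle=\{U:\widehat U\le U\le\widetilde U\text{ on }\overline\Omega^h\}$. A maximal (minimal) solution is meant relative to the sector: a solution that is $\ge$ ($\le$) every solution in the sector. Block form. Put $l_{\alpha,ij}=\varepsilon_\alpha/h_x^2+v_\alpha(x_i,y_j)/h_x$, $r_{\alpha,ij}=\varepsilon_\alpha/h_x^2$, $b_{\alpha,ij}=\varepsilon_\alpha/h_y^2+v_\alpha(x_i,y_j)/h_y$, $t_{\alpha,ij}=\varepsilon_\alpha/h_y^2$, $d_{\alpha,ij}=l_{\alpha,ij}+r_{\alpha,ij}+b_{\alpha,ij}+t_{\alpha,ij}$. For $i=0,\dots,N_x$ let $U_{\alpha,i}=(U_{\alpha,i,1},\dots,U_{\alpha,i,N_y-1})^T$, $U_i=(U_{1,i},U_{2,i})$ and $g_{\alpha,i}=(g_\alpha(x_i,y_1),\dots,g_\alpha(x_i,y_{N_y-1}))^T$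 (for $i=0,N_x$). For $1\le i\le N_x-1$ let $L_{\alpha,i}=\mathrm{diag}(l_{\alpha,i,1},\dots,l_{\alpha,i,N_y-1})$, $R_{\alpha,i}=\mathrm{diag}(r_{\alpha,i,1},\dots,r_{\alpha,i,N_y-1})$, $C_{\alpha,i}=\mathrm{diag}(c_\alpha(x_i,y_1),\dots,c_\alpha(x_i,y_{N_y-1}))$ with $c_\alpha$ the functions bounding $\partial f_\alpha/\partial u_\alpha$; let $A_{\alpha,i}$ be the tridiagonal matrix with diagonal entries $d_{\alpha,ij}$ in row $j$, subdiagonal entries $-b_{\alpha,ij}$ in row $j$ ($j=2,\dots,N_y-1$), and superdiagonal entries $-t_{\alpha,ij}$ in row $j$ ($j=1,\dots,N_y-2$); let $F_{\alpha,i}(U_i)$ be the vector with entries $f_\alpha(x_i,y_j,U_{1,ij},U_{2,ij})$, $j=1,\dots,N_y-1$; and let $G^*_{\alpha,i}$ be the vector of boundary contributions from $y=0$ and $y=1$, i.e. with $b_{\alpha,i,1}g_\alpha(x_i,0)$ added to its first entry and $t_{\alpha,i,N_y-1}g_\alpha(x_i,1)$ added to its last entry, all other contributions being zero. The difference scheme is then $\mathcal K_{\alpha,i}(U_i)=\mathbf 0$ for $1\le i\le N_x-1$, with $U_{\alpha,i}=g_{\alpha,i}$ for $i=0,N_x$, where the residual is $$\mathcal K_{\alpha,i}(U_i)=A_{\alpha,i}U_{\alpha,i}-L_{\alpha,i}U_{\alpha,i-1}-R_{\alpha,i}U_{\alpha,i+1}+F_{\alpha,i}(U_i)-G^*_{\alpha,i}.$$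 Block Jacobi method: given $U^{(0)}$, for $n\ge1$ and $\alpha=1,2$ set $U^{(n)}_{\alpha,i}=U^{(n-1)}_{\alpha,i}+Z^{(n)}_{\alpha,i}$, where $$A_{\alpha,i}Z^{(n)}_{\alpha,i}+C_{\alpha,i}Z^{(n)}_{\alpha,i}=-\mathcal K_{\alpha,i}(U^{(n-1)}_i),\quad i=1,\dots,N_x-1,$$ and for $i=0,N_x$: $Z^{(1)}_{\alpha,i}=g_{\alpha,i}-U^{(0)}_{\alpha,i}$ and $Z^{(n)}_{\alpha,i}=\mathbf 0$ for $n\ge2$. On the mesh lines $y=0$ and $y=1$ the iterates $U^{(n)}$, $n\ge1$, are taken equal to $g$. *)

theory Defs
  imports "HOL-Analysis.Analysis" "Jordan_Normal_Form.Matrix"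
begin

no_notation Matrix.vec_index (infixl "$" 100)

section \<open>Smooth functions\<close>

text \<open>\<open>Ck_on k T F\<close> is the usual class of \<open>k\<close> times continuously differentiable functions
  when \<open>T\<close> is open. On an arbitrary set, smooth means being the restriction of a
  function that is smooth on some open superset.\<close>

primrec Ck_on :: "nat \<Rightarrow> 'a::euclidean_space set \<Rightarrow> ('a \<Rightarrow> real) \<Rightarrow> bool" where
  "Ck_on 0 T F \<longleftrightarrow> continuous_on T F"
| "Ck_on (Suc k) T F \<longleftrightarrow> (\<forall>p\<in>T. F differentiable (at p)) \<and>
     (\<forall>b\<in>Basis. Ck_on k T (\<lambda>p. frechet_derivative F (at p) b))"

definition smooth_on :: "'a::euclidean_space set \<Rightarrow> ('a \<Rightarrow> real) \<Rightarrow> bool" where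
  "smooth_on S f \<longleftrightarrow>
     (\<exists>T F. open T \<and> S \<subseteq> T \<and> (\<forall>k. Ck_on k T F) \<and> (\<forall>p\<in>S. F p = f p))"

text \<open>Partial derivative with respect to \<open>u\<^sub>\<beta>\<close> of a function of \<open>u = (u\<^sub>1, u\<^sub>2)\<close>.\<close>

definition partial_u :: "2 \<Rightarrow> (real^2 \<Rightarrow> real) \<Rightarrow> real^2 \<Rightarrow> real" where
  "partial_u \<beta> F u = deriv (\<lambda>s. F (\<chi> \<gamma>. if \<gamma> = \<beta> then s else u $ \<gamma>)) (u $ \<beta>)"

section \<open>The nonlinear difference scheme\<close>

definition omega :: "(real \<times> real) set" where
  "omega = {0<..<1} \<times> {0<..<1}"

text \<open>The two components are indexed by the two-element type \<open>2\<close>, whose elements are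
  \<open>1\<close> and \<open>2 = 0\<close>.\<close>

record problem =
  Nx :: nat
  Ny :: nat
  eps :: "2 \<Rightarrow> real"
  vel :: "2 \<Rightarrow> real \<Rightarrow> real \<Rightarrow> real"
  react :: "2 \<Rightarrow> real \<Rightarrow> real \<Rightarrow> real^2 \<Rightarrow> real"
  bdry :: "2 \<Rightarrow> real \<Rightarrow> real \<Rightarrow> real"

text \<open>A pair of mesh functions is represented by its values \<open>U \<alpha> i j\<close> at the mesh points
  \<open>(x\<^sub>i, y\<^sub>j)\<close>; values at indices outside the mesh are irrelevant.\<close>

type_synonym mesh_fun = "2 \<Rightarrow> nat \<Rightarrow> nat \<Rightarrow> real"

definition hx :: "problem \<Rightarrow> real" where "hx P = 1 / real (Nx P)"
definition hy :: "problem \<Rightarrow> real" where "hy P = 1 / real (Ny P)"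
definition xpt :: "problem \<Rightarrow> nat \<Rightarrow> real" where "xpt P i = real i * hx P"
definition ypt :: "problem \<Rightarrow> nat \<Rightarrow> real" where "ypt P j = real j * hy P"

definition mesh :: "problem \<Rightarrow> (nat \<times> nat) set" where
  "mesh P = {0..Nx P} \<times> {0..Ny P}"

definition mesh_interior :: "problem \<Rightarrow> (nat \<times> nat) set" where
  "mesh_interior P = {1..Nx P - 1} \<times> {1..Ny P - 1}"

definition mesh_boundary :: "problem \<Rightarrow> (nat \<times> nat) set" where
  "mesh_boundary P = mesh P - mesh_interior P"

definition at_pt :: "mesh_fun \<Rightarrow> nat \<Rightarrow> nat \<Rightarrow> real^2" where
  "at_pt U i j = (\<chi> \<alpha>. U \<alpha> i j)"

definition bdry_mesh :: "problem \<Rightarrow> mesh_fun" where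
  "bdry_mesh P \<alpha> i j = bdry P \<alpha> (xpt P i) (ypt P j)"

definition mesh_le_on :: "(nat \<times> nat) set \<Rightarrow> mesh_fun \<Rightarrow> mesh_fun \<Rightarrow> bool" where
  "mesh_le_on M U V \<longleftrightarrow> (\<forall>\<alpha>. \<forall>(i, j)\<in>M. U \<alpha> i j \<le> V \<alpha> i j)"

definition diff_op :: "problem \<Rightarrow> 2 \<Rightarrow> nat \<Rightarrow> nat \<Rightarrow> (nat \<Rightarrow> nat \<Rightarrow> real) \<Rightarrow> real" where
  "diff_op P \<alpha> i j W =
     - eps P \<alpha> * ((W (i - 1) j - 2 * W i j + W (i + 1) j) / (hx P)\<^sup>2
                  + (W i (j - 1) - 2 * W i j + W i (j + 1)) / (hy P)\<^sup>2)
     + vel P \<alpha> (xpt P i) (ypt P j)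
         * ((W i j - W (i - 1) j) / hx P + (W i j - W i (j - 1)) / hy P)"

definition scheme_lhs :: "problem \<Rightarrow> mesh_fun \<Rightarrow> 2 \<Rightarrow> nat \<Rightarrow> nat \<Rightarrow> real" where
  "scheme_lhs P U \<alpha> i j =
     diff_op P \<alpha> i j (U \<alpha>) + react P \<alpha> (xpt P i) (ypt P j) (at_pt U i j)"

definition scheme_solution :: "problem \<Rightarrow> mesh_fun \<Rightarrow> bool" where
  "scheme_solution P U \<longleftrightarrow>
     (\<forall>\<alpha>. \<forall>(i, j)\<in>mesh_interior P. scheme_lhs P U \<alpha> i j = 0) \<and>
     (\<forall>\<alpha>. \<forall>(i, j)\<in>mesh_boundary P. U \<alpha> i j = bdry_mesh P \<alpha> i j)"

definition ordered_upper_lower :: "problem \<Rightarrow> mesh_fun \<Rightarrow> mesh_fun \<Rightarrow> bool" where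
  "ordered_upper_lower P Ut Uh \<longleftrightarrow>
     mesh_le_on (mesh P) Uh Ut \<and>
     (\<forall>\<alpha>. \<forall>(i, j)\<in>mesh_interior P. scheme_lhs P Ut \<alpha> i j \<ge> 0 \<and> scheme_lhs P Uh \<alpha> i j \<le> 0) \<and>
     mesh_le_on (mesh_boundary P) Uh (bdry_mesh P) \<and>
     mesh_le_on (mesh_boundary P) (bdry_mesh P) Ut"

definition sector :: "problem \<Rightarrow> mesh_fun \<Rightarrow> mesh_fun \<Rightarrow> mesh_fun set" where
  "sector P Uh Ut = {U. mesh_le_on (mesh P) Uh U \<and> mesh_le_on (mesh P) U Ut}"

definition maximal_solution :: "problem \<Rightarrow> mesh_fun \<Rightarrow> mesh_fun \<Rightarrow> mesh_fun \<Rightarrow> bool" where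
  "maximal_solution P Uh Ut U \<longleftrightarrow> scheme_solution P U \<and>
     (\<forall>S\<in>sector P Uh Ut. scheme_solution P S \<longrightarrow> mesh_le_on (mesh P) S U)"

definition minimal_solution :: "problem \<Rightarrow> mesh_fun \<Rightarrow> mesh_fun \<Rightarrow> mesh_fun \<Rightarrow> bool" where
  "minimal_solution P Uh Ut U \<longleftrightarrow> scheme_solution P U \<and>
     (\<forall>S\<in>sector P Uh Ut. scheme_solution P S \<longrightarrow> mesh_le_on (mesh P) U S)"

section \<open>Block form and the block Jacobi method\<close>

text \<open>Vectors and matrices are indexed from \<open>0\<close>: position \<open>k\<close> corresponds to the mesh index
  \<open>j = k + 1\<close>, for \<open>j = 1, \<dots>, N\<^sub>y - 1\<close>.\<close>

definition l_coef :: "problem \<Rightarrow> 2 \<Rightarrow> nat \<Rightarrow> nat \<Rightarrow> real" where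
  "l_coef P \<alpha> i j = eps P \<alpha> / (hx P)\<^sup>2 + vel P \<alpha> (xpt P i) (ypt P j) / hx P"

definition r_coef :: "problem \<Rightarrow> 2 \<Rightarrow> nat \<Rightarrow> nat \<Rightarrow> real" where
  "r_coef P \<alpha> i j = eps P \<alpha> / (hx P)\<^sup>2"

definition b_coef :: "problem \<Rightarrow> 2 \<Rightarrow> nat \<Rightarrow> nat \<Rightarrow> real" where
  "b_coef P \<alpha> i j = eps P \<alpha> / (hy P)\<^sup>2 + vel P \<alpha> (xpt P i) (ypt P j) / hy P"

definition t_coef :: "problem \<Rightarrow> 2 \<Rightarrow> nat \<Rightarrow> nat \<Rightarrow> real" where
  "t_coef P \<alpha> i j = eps P \<alpha> / (hy P)\<^sup>2"

definition d_coef :: "problem \<Rightarrow> 2 \<Rightarrow> nat \<Rightarrow> nat \<Rightarrow> real" where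
  "d_coef P \<alpha> i j = l_coef P \<alpha> i j + r_coef P \<alpha> i j + b_coef P \<alpha> i j + t_coef P \<alpha> i j"

definition line :: "problem \<Rightarrow> (nat \<Rightarrow> nat \<Rightarrow> real) \<Rightarrow> nat \<Rightarrow> real Matrix.vec" where
  "line P W i = Matrix.vec (Ny P - 1) (\<lambda>k. W i (k + 1))"

definition L_mat :: "problem \<Rightarrow> 2 \<Rightarrow> nat \<Rightarrow> real Matrix.mat" where
  "L_mat P \<alpha> i = mat_diag (Ny P - 1) (\<lambda>k. l_coef P \<alpha> i (k + 1))"

definition R_mat :: "problem \<Rightarrow> 2 \<Rightarrow> nat \<Rightarrow> real Matrix.mat" where
  "R_mat P \<alpha> i = mat_diag (Ny P - 1) (\<lambda>k. r_coef P \<alpha> i (k + 1))"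

definition C_mat :: "problem \<Rightarrow> mesh_fun \<Rightarrow> 2 \<Rightarrow> nat \<Rightarrow> real Matrix.mat" where
  "C_mat P c \<alpha> i = mat_diag (Ny P - 1) (\<lambda>k. c \<alpha> i (k + 1))"

definition A_mat :: "problem \<Rightarrow> 2 \<Rightarrow> nat \<Rightarrow> real Matrix.mat" where
  "A_mat P \<alpha> i = Matrix.mat (Ny P - 1) (Ny P - 1) (\<lambda>(k, m).
     if m = k then d_coef P \<alpha> i (k + 1)
     else if m + 1 = k then - b_coef P \<alpha> i (k + 1)
     else if m = k + 1 then - t_coef P \<alpha> i (k + 1)
     else 0)"

definition F_vec :: "problem \<Rightarrow> 2 \<Rightarrow> nat \<Rightarrow> mesh_fun \<Rightarrow> real Matrix.vec" where
  "F_vec P \<alpha> i U = Matrix.vec (Ny P - 1)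
     (\<lambda>k. react P \<alpha> (xpt P i) (ypt P (k + 1)) (at_pt U i (k + 1)))"

text \<open>The two contributions are added to the same entry if \<open>N\<^sub>y = 2\<close>.\<close>

definition G_vec :: "problem \<Rightarrow> 2 \<Rightarrow> nat \<Rightarrow> real Matrix.vec" where
  "G_vec P \<alpha> i = Matrix.vec (Ny P - 1) (\<lambda>k.
     (if k + 1 = 1 then b_coef P \<alpha> i 1 * bdry P \<alpha> (xpt P i) 0 else 0) +
     (if k + 1 = Ny P - 1 then t_coef P \<alpha> i (Ny P - 1) * bdry P \<alpha> (xpt P i) 1 else 0))"

definition residual :: "problem \<Rightarrow> 2 \<Rightarrow> nat \<Rightarrow> mesh_fun \<Rightarrow> real Matrix.vec" where
  "residual P \<alpha> i U =
     A_mat P \<alpha> i *\<^sub>v line P (U \<alpha>) i - L_mat P \<alpha> i *\<^sub>v line P (U \<alpha>) (i - 1)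
     - R_mat P \<alpha> i *\<^sub>v line P (U \<alpha>) (i + 1) + F_vec P \<alpha> i U - G_vec P \<alpha> i"

text \<open>\<open>block_jacobi P c U0 W\<close>: the sequence \<open>W\<close> of mesh functions is generated by the block
  Jacobi method from the initial iterate \<open>U0\<close>.\<close>

definition block_jacobi ::
    "problem \<Rightarrow> mesh_fun \<Rightarrow> mesh_fun \<Rightarrow> (nat \<Rightarrow> mesh_fun) \<Rightarrow> bool" where
  "block_jacobi P c U0 W \<longleftrightarrow>
     (\<forall>\<alpha>. \<forall>(i, j)\<in>mesh P. W 0 \<alpha> i j = U0 \<alpha> i j) \<and>
     (\<exists>Z :: nat \<Rightarrow> 2 \<Rightarrow> nat \<Rightarrow> real Matrix.vec. \<forall>n\<ge>1. \<forall>\<alpha>.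
        (\<forall>i\<le>Nx P. Z n \<alpha> i \<in> carrier_vec (Ny P - 1) \<and>
           line P (W n \<alpha>) i = line P (W (n - 1) \<alpha>) i + Z n \<alpha> i) \<and>
        (\<forall>i\<in>{1..Nx P - 1}.
           A_mat P \<alpha> i *\<^sub>v Z n \<alpha> i + C_mat P c \<alpha> i *\<^sub>v Z n \<alpha> i = - residual P \<alpha> i (W (n - 1))) \<and>
        (\<forall>i\<in>{0, Nx P}.
           Z n \<alpha> i = (if n = 1 then line P (bdry_mesh P \<alpha>) i - line P (W 0 \<alpha>) i
                       else 0\<^sub>v (Ny P - 1)))) \<and>
     (\<forall>n\<ge>1. \<forall>\<alpha>. \<forall>i\<le>Nx P. \<forall>j\<in>{0, Ny P}. W n \<alpha> i j = bdry_mesh P \<alpha> i j)"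

end

theory Submission
  imports Defs
begin

text \<open>On each mesh line the scheme splits as \<open>M U = T U\<close>, where \<open>M\<close> is the tridiagonal operator
  \<open>A + C\<close> acting in the \<open>y\<close>-direction and \<open>T U\<close> collects the neighbouring lines and
  \<open>C U - F(U)\<close>. A Jacobi step is \<open>M W = T U\<close> with \<open>W = g\<close> on the boundary. Strict diagonal
  dominance makes \<open>M\<close> inverse monotone, and the bounds on the derivatives of \<open>f\<close> make \<open>T\<close> monotone
  on the sector. Hence \<open>M W \<le> T U\<close>, \<open>T U' \<le> M W'\<close> and \<open>U \<le> U'\<close> imply \<open>W \<le> W'\<close>; this single
  comparison principle yields monotonicity of the iterates, their ordering, and the extremality of
  the limits.\<close>

section \<open>Tridiagonal systems\<close>

text \<open>A discrete minimum principle. At a negative minimum \<open>m\<close> both neighbours are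
  at least as large, so the expression in \<open>eq\<close> is at most
  \<open>(a m - b m - t m) * V m\<close>, which is negative by strict dominance.\<close>

lemma tridiag_nonneg:
  fixes V a b t :: "nat \<Rightarrow> real"
  assumes coef: "\<And>j. 0 < j \<Longrightarrow> j < N \<Longrightarrow> b j \<ge> 0 \<and> t j \<ge> 0 \<and> b j + t j < a j"
    and ends: "V 0 \<ge> 0" "V N \<ge> 0"
    and eq: "\<And>j. 0 < j \<Longrightarrow> j < N \<Longrightarrow> a j * V j - b j * V (j - 1) - t j * V (j + 1) \<ge> 0"
    and "j \<le> N"
  shows "V j \<ge> 0"
proof (rule ccontr)
  assume "\<not> V j \<ge> 0"
  have "Min (V ` {..N}) \<in> V ` {..N}"
    by (intro Min_in) auto
  then obtain m where m: "m \<in> {..N}" "V m = Min (V ` {..N})"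
    by (auto simp: image_iff)
  have least: "V m \<le> V k" if "k \<in> {..N}" for k
    unfolding m(2) using that by (intro Min_le) auto
  have neg: "V m < 0"
    using least[of j] \<open>j \<le> N\<close> \<open>\<not> V j \<ge> 0\<close> by simp
  \<comment> \<open>The end values are nonnegative, so a negative minimum sits at an inner index,
    where \<open>coef\<close> and \<open>eq\<close> are available.\<close>
  then have "m \<noteq> 0" "m \<noteq> N"
    using ends by (metis not_less)+
  then have pos: "0 < m" "m < N"
    using m(1) by auto
  have "b m * V m \<le> b m * V (m - 1)" "t m * V m \<le> t m * V (m + 1)"
    using least[of "m - 1"] least[of "m + 1"] coef[OF pos] pos by (auto intro!: mult_left_mono)
  then have "a m * V m - b m * V (m - 1) - t m * V (m + 1) \<le> (a m - b m - t m) * V m"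
    by (simp add: algebra_simps)
  also have "\<dots> < 0"
    using coef[OF pos] neg by (auto intro!: mult_pos_neg)
  finally show False
    using eq[OF pos] by simp
qed

lemma second_order_recursion:
  fixes a b t q :: "nat \<Rightarrow> real"
  assumes "\<And>j. 0 < j \<Longrightarrow> j < N \<Longrightarrow> t j \<noteq> 0"
  obtains V where "V 0 = v0" "V (Suc 0) = v1"
    "\<And>j. 0 < j \<Longrightarrow> j < N \<Longrightarrow> a j * V j - b j * V (j - 1) - t j * V (j + 1) = q j"
proof -
  \<comment> \<open>The pair at stage \<open>k\<close> is \<open>(V k, V (k + 1))\<close>; equation
    \<open>k + 1\<close> is solved for \<open>V (k + 2)\<close>. A zero divisor can occur only at an
    index not below \<open>N\<close> and then affects only values beyond \<open>V N\<close>.\<close>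
  define p where "p = rec_nat (v0, v1) (\<lambda>k (x, y).
    (y, (a (Suc k) * y - b (Suc k) * x - q (Suc k)) / t (Suc k)))"
  define V where "V = (\<lambda>j. fst (p j))"
  have p_Suc: "p (Suc k) = (snd (p k), (a (Suc k) * snd (p k) - b (Suc k) * fst (p k) - q (Suc k)) / t (Suc k))"
    for k
    unfolding p_def by (simp add: case_prod_beta)
  have "V 0 = v0" "V (Suc 0) = v1"
    unfolding V_def p_def by simp_all
  moreover have "a j * V j - b j * V (j - 1) - t j * V (j + 1) = q j" if j: "0 < j" "j < N" for j
  proof -
    obtain k where k: "j = Suc k"
      using j(1) gr0_implies_Suc by blast
    have "V j = snd (p k)" "V (j - 1) = fst (p k)"
      "V (j + 1) = (a j * snd (p k) - b j * fst (p k) - q j) / t j"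
      unfolding V_def k using p_Suc[of k] p_Suc[of "Suc k"] by simp_all
    then show ?thesis
      using assms[OF j] by simp
  qed
  ultimately show thesis
    by (rule that)
qed

text \<open>Shooting: the homogeneous solution \<open>H\<close> with \<open>H 0 = 0\<close> and \<open>H 1 = 1\<close> cannot vanish at \<open>N\<close>, so a
  suitable multiple of it corrects the end value of a particular solution.\<close>

lemma tridiag_solvable:
  fixes a b t q :: "nat \<Rightarrow> real"
  assumes "N \<ge> 1"
    and coef: "\<And>j. 0 < j \<Longrightarrow> j < N \<Longrightarrow> b j \<ge> 0 \<and> t j > 0 \<and> b j + t j < a j"
  obtains V where "V 0 = v0" "V N = vN"
    "\<And>j. 0 < j \<Longrightarrow> j < N \<Longrightarrow> a j * V j - b j * V (j - 1) - t j * V (j + 1) = q j"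
proof -
  have nz: "t j \<noteq> 0" if "0 < j" "j < N" for j
    using coef[OF that] by simp
  obtain H where H: "H 0 = 0" "H (Suc 0) = 1"
    and Heq: "\<And>j. 0 < j \<Longrightarrow> j < N \<Longrightarrow> a j * H j - b j * H (j - 1) - t j * H (j + 1) = 0"
    by (rule second_order_recursion[of N t 0 1 a b "\<lambda>_. 0"]) (rule nz that; assumption)+
  \<comment> \<open>The second starting value 0 is arbitrary: the multiple of \<open>H\<close> added
    below corrects whatever \<open>G N\<close> comes out.\<close>
  obtain G where G: "G 0 = v0"
    and Geq: "\<And>j. 0 < j \<Longrightarrow> j < N \<Longrightarrow> a j * G j - b j * G (j - 1) - t j * G (j + 1) = q j"
    by (rule second_order_recursion[of N t v0 0 a b q]) (rule nz that; assumption)+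
  have "H N \<noteq> 0"
  proof
    assume HN: "H N = 0"
    have neg_eq: "a j * - H j - b j * - H (j - 1) - t j * - H (j + 1) \<ge> 0"
      if "0 < j" "j < N" for j
      using Heq[OF that] by (simp add: algebra_simps)
    \<comment> \<open>With both end values zero, the minimum principle applied to \<open>- H\<close>
      forces \<open>H 1\<close> to be at most 0, against \<open>H 1 = 1\<close>.\<close>
    have "- H (Suc 0) \<ge> 0"
      by (rule tridiag_nonneg[where V = "\<lambda>j. - H j" and N = N and a = a and b = b and t = t])
        (use coef neg_eq HN H(1) \<open>N \<ge> 1\<close> in \<open>auto intro: less_imp_le\<close>)
    then show False
      using H(2) by simp
  qed
  define s where "s = (vN - G N) / H N"
  define V where "V = (\<lambda>j. G j + s * H j)"
  have "V 0 = v0" "V N = vN"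
    using H G \<open>H N \<noteq> 0\<close> by (simp_all add: V_def s_def)
  moreover have "a j * V j - b j * V (j - 1) - t j * V (j + 1) = q j" if "0 < j" "j < N" for j
  proof -
    have "a j * V j - b j * V (j - 1) - t j * V (j + 1)
      = (a j * G j - b j * G (j - 1) - t j * G (j + 1))
        + s * (a j * H j - b j * H (j - 1) - t j * H (j + 1))"
      by (simp add: V_def algebra_simps)
    then show ?thesis
      using Heq[OF that] Geq[OF that] by simp
  qed
  ultimately show thesis
    by (rule that)
qed

section \<open>One-sided Lipschitz bounds from partial derivatives\<close>

text \<open>Has the form of the vector inside \<open>partial_u\<close>, so that partial derivatives
  become ordinary derivatives of one-variable slices.\<close>

definition upd :: "real^2 \<Rightarrow> 2 \<Rightarrow> real \<Rightarrow> real^2" where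
  "upd u \<beta> s = (\<chi> \<gamma>. if \<gamma> = \<beta> then s else u $ \<gamma>)"

lemma upd_nth: "upd u \<beta> s $ \<gamma> = (if \<gamma> = \<beta> then s else u $ \<gamma>)"
  by (simp add: upd_def)

lemma upd_has_derivative:
  "((\<lambda>s. upd u \<beta> s) has_derivative (\<lambda>h. h *\<^sub>R axis \<beta> 1)) (at s)"
proof -
  have eq: "(\<lambda>s. upd u \<beta> s) = (\<lambda>s. upd u \<beta> 0 + s *\<^sub>R axis \<beta> 1)"
    by (auto simp: fun_eq_iff Finite_Cartesian_Product.vec_eq_iff upd_nth axis_def)
  show ?thesis
    by (subst eq) (auto intro!: derivative_eq_intros)
qed

text \<open>\<open>partial_u\<close> is built on \<open>deriv\<close>, whose value is meaningful
  only where a derivative exists. Differentiability of \<phi>, composed with the affine map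
  \<open>upd u \<beta>\<close>, provides that derivative.\<close>

lemma partial_u_DERIV:
  assumes "\<And>u. \<phi> differentiable (at u)"
  shows "((\<lambda>s. \<phi> (upd u \<beta> s)) has_real_derivative partial_u \<beta> \<phi> (upd u \<beta> s)) (at s)"
proof -
  \<comment> \<open>Of two successive changes of component \<beta> only the last survives, so the
    partial derivative at \<open>upd u \<beta> s\<close> belongs to the same slice.\<close>
  have override: "(\<chi> \<gamma>. if \<gamma> = \<beta> then t else if \<gamma> = \<beta> then s else u $ \<gamma>) = upd u \<beta> t" for t
    by (simp add: Finite_Cartesian_Product.vec_eq_iff upd_nth)
  obtain D where "(\<phi> has_derivative D) (at (upd u \<beta> s))"
    using assms unfolding differentiable_def by metis
  from diff_chain_at[OF upd_has_derivative this]
  have "(\<lambda>s. \<phi> (upd u \<beta> s)) differentiable (at s)"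
    unfolding comp_def by (rule differentiableI)
  then have deriv: "((\<lambda>s. \<phi> (upd u \<beta> s)) has_real_derivative deriv (\<lambda>s. \<phi> (upd u \<beta> s)) s) (at s)"
    by (rule DERIV_deriv_iff_real_differentiable[THEN iffD2])
  have "partial_u \<beta> \<phi> (upd u \<beta> s) = deriv (\<lambda>s. \<phi> (upd u \<beta> s)) s"
    unfolding partial_u_def upd_nth if_P[OF refl] override ..
  then show ?thesis
    by (rule ssubst) (rule deriv)
qed

text \<open>The mean value theorem along a slice; equal endpoints are split off because it requires
  a nondegenerate interval.\<close>

lemma partial_u_increment:
  assumes "\<And>u. \<phi> differentiable (at u)"
    and "p \<le> q" and "\<And>s. p \<le> s \<Longrightarrow> s \<le> q \<Longrightarrow> partial_u \<beta> \<phi> (upd u \<beta> s) \<le> B"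
  shows "\<phi> (upd u \<beta> q) - \<phi> (upd u \<beta> p) \<le> B * (q - p)"
proof (cases "p = q")
  case False
  then obtain z where "p < z" "z < q"
    "\<phi> (upd u \<beta> q) - \<phi> (upd u \<beta> p) = (q - p) * partial_u \<beta> \<phi> (upd u \<beta> z)"
    using MVT2[of p q "\<lambda>s. \<phi> (upd u \<beta> s)" "\<lambda>s. partial_u \<beta> \<phi> (upd u \<beta> s)"]
      partial_u_DERIV[OF assms(1)] assms(2) by auto
  then show ?thesis
    using assms(2) assms(3)[of z] by (simp add: mult.commute mult_left_mono)
qed simp

text \<open>The path from \<open>w\<close> to \<open>u\<close> follows two coordinate segments
  inside the box. Along the \<alpha>-segment \<phi> grows by at most \<open>B\<close> times its
  length; along the other one it does not increase.\<close>

lemma quasimonotone_increment: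
  assumes diff: "\<And>u. \<phi> differentiable (at u)"
    and diag: "\<And>u. (\<And>\<gamma>. lo $ \<gamma> \<le> u $ \<gamma> \<and> u $ \<gamma> \<le> hi $ \<gamma>) \<Longrightarrow> partial_u \<alpha> \<phi> u \<le> B"
    and off: "\<And>u \<beta>. \<beta> \<noteq> \<alpha> \<Longrightarrow> (\<And>\<gamma>. lo $ \<gamma> \<le> u $ \<gamma> \<and> u $ \<gamma> \<le> hi $ \<gamma>) \<Longrightarrow> partial_u \<beta> \<phi> u \<le> 0"
    and box: "\<And>\<gamma>. lo $ \<gamma> \<le> w $ \<gamma>" "\<And>\<gamma>. w $ \<gamma> \<le> u $ \<gamma>" "\<And>\<gamma>. u $ \<gamma> \<le> hi $ \<gamma>"
  shows "\<phi> u - \<phi> w \<le> B * (u $ \<alpha> - w $ \<alpha>)"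
proof -
  have "\<exists>\<beta>. \<beta> \<noteq> \<alpha> \<and> (\<forall>\<gamma>. \<gamma> = \<alpha> \<or> \<gamma> = \<beta>)"
    by (rule exI[of _ "if \<alpha> = 1 then 2 else 1"])
      (use exhaust_2[of \<alpha>] in \<open>auto simp: forall_2\<close>)
  then obtain \<beta> where \<beta>: "\<beta> \<noteq> \<alpha>" "\<And>\<gamma>. \<gamma> = \<alpha> \<or> \<gamma> = \<beta>"
    by auto
  \<comment> \<open>The corner of the path: component \<alpha> has been moved already, the other one
    is still that of \<open>w\<close>.\<close>
  define v where "v = upd w \<alpha> (u $ \<alpha>)"
  have ends: "upd w \<alpha> (w $ \<alpha>) = w" "upd v \<beta> (w $ \<beta>) = v" "upd v \<beta> (u $ \<beta>) = u"
    using \<beta> by (auto simp: Finite_Cartesian_Product.vec_eq_iff upd_nth v_def)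
  have "\<phi> (upd w \<alpha> (u $ \<alpha>)) - \<phi> (upd w \<alpha> (w $ \<alpha>)) \<le> B * (u $ \<alpha> - w $ \<alpha>)"
  proof (rule partial_u_increment[OF diff box(2)], rule diag)
    fix s \<gamma> assume "w $ \<alpha> \<le> s" "s \<le> u $ \<alpha>"
    then show "lo $ \<gamma> \<le> upd w \<alpha> s $ \<gamma> \<and> upd w \<alpha> s $ \<gamma> \<le> hi $ \<gamma>"
      using box[of \<gamma>] by (auto simp: upd_nth)
  qed
  moreover have "\<phi> (upd v \<beta> (u $ \<beta>)) - \<phi> (upd v \<beta> (w $ \<beta>)) \<le> 0 * (u $ \<beta> - w $ \<beta>)"
  proof (rule partial_u_increment[OF diff box(2)], rule off[OF \<beta>(1)])
    fix s \<gamma> assume "w $ \<beta> \<le> s" "s \<le> u $ \<beta>"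
    then show "lo $ \<gamma> \<le> upd v \<beta> s $ \<gamma> \<and> upd v \<beta> s $ \<gamma> \<le> hi $ \<gamma>"
      using box[of \<gamma>] by (auto simp: upd_nth v_def)
  qed
  ultimately show ?thesis
    unfolding ends by (simp add: v_def)
qed

text \<open>The point \<open>(x, y)\<close> may lie on the boundary of \<open>D\<close>, so the
  derivative is taken from the extension \<open>F\<close> on an open set. The variable
  \<open>u\<close> is unrestricted, hence \<open>F\<close> and \<open>f\<close> agree on the whole
  slice and the chain rule transfers the derivative.\<close>

lemma smooth_on_slice_differentiable:
  fixes f :: "real \<Rightarrow> real \<Rightarrow> real^2 \<Rightarrow> real"
  assumes "smooth_on {(x, y, u). (x, y) \<in> D} (\<lambda>(x, y, u). f x y u)" and "(x, y) \<in> D"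
  shows "f x y differentiable (at u)"
proof -
  obtain T F where T: "{(x, y, u). (x, y) \<in> D} \<subseteq> T" and Ck: "Ck_on 1 T F"
    and F: "\<forall>p\<in>{(x, y, u). (x, y) \<in> D}. F p = (\<lambda>(x, y, u). f x y u) p"
    using assms(1) unfolding smooth_on_def by metis
  have F_eq: "F (x, y, w) = f x y w" for w
    using F assms(2) by simp
  have "(x, y, u) \<in> T"
    using T assms(2) by (simp add: subset_eq)
  moreover have "\<forall>p\<in>T. F differentiable (at p)"
    using Ck by simp
  ultimately have diff: "F differentiable (at (x, y, u))"
    by (rule bspec[rotated])
  have "(\<lambda>w. (x, y, w)) differentiable (at u)"
    by (rule differentiableI) (rule derivative_eq_intros refl)+
  from differentiable_chain_at[OF this diff] show ?thesis
    unfolding comp_def F_eq .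
qed

section \<open>The block Jacobi method in pointwise form\<close>

text \<open>The operator \<open>M\<close>. The values at \<open>j = 0\<close> and
  \<open>j = Ny\<close> stay inside the formula, which absorbs the boundary vector
  \<open>G_vec\<close> once \<open>W\<close> equals the boundary data there.\<close>

definition implicit_op :: "problem \<Rightarrow> mesh_fun \<Rightarrow> mesh_fun \<Rightarrow> mesh_fun" where
  "implicit_op P c W \<alpha> i j = (d_coef P \<alpha> i j + c \<alpha> i j) * W \<alpha> i j
     - b_coef P \<alpha> i j * W \<alpha> i (j - 1) - t_coef P \<alpha> i j * W \<alpha> i (j + 1)"

definition explicit_op :: "problem \<Rightarrow> mesh_fun \<Rightarrow> mesh_fun \<Rightarrow> mesh_fun" where
  "explicit_op P c U \<alpha> i j = l_coef P \<alpha> i j * U \<alpha> (i - 1) j + r_coef P \<alpha> i j * U \<alpha> (i + 1) j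
     + c \<alpha> i j * U \<alpha> i j - react P \<alpha> (xpt P i) (ypt P j) (at_pt U i j)"

text \<open>One-sided Jacobi steps. Upper and lower solutions satisfy only inequalities, and in this
  form they can be compared with genuine iterates.\<close>

definition sub_step :: "problem \<Rightarrow> mesh_fun \<Rightarrow> mesh_fun \<Rightarrow> mesh_fun \<Rightarrow> bool" where
  "sub_step P c U W \<longleftrightarrow> mesh_le_on (mesh_interior P) (implicit_op P c W) (explicit_op P c U) \<and>
     mesh_le_on (mesh_boundary P) W (bdry_mesh P)"

definition super_step :: "problem \<Rightarrow> mesh_fun \<Rightarrow> mesh_fun \<Rightarrow> mesh_fun \<Rightarrow> bool" where
  "super_step P c U W \<longleftrightarrow> mesh_le_on (mesh_interior P) (explicit_op P c U) (implicit_op P c W) \<and>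
     mesh_le_on (mesh_boundary P) (bdry_mesh P) W"

definition jacobi_step :: "problem \<Rightarrow> mesh_fun \<Rightarrow> mesh_fun \<Rightarrow> mesh_fun \<Rightarrow> bool" where
  "jacobi_step P c U W \<longleftrightarrow> sub_step P c U W \<and> super_step P c U W"

lemma jacobi_step_iff:
  "jacobi_step P c U W \<longleftrightarrow>
     (\<forall>\<alpha>. \<forall>(i, j)\<in>mesh_interior P. implicit_op P c W \<alpha> i j = explicit_op P c U \<alpha> i j) \<and>
     (\<forall>\<alpha>. \<forall>(i, j)\<in>mesh_boundary P. W \<alpha> i j = bdry_mesh P \<alpha> i j)"
  unfolding jacobi_step_def sub_step_def super_step_def mesh_le_on_def order.eq_iff[where 'a = real]
  by (auto simp: split_beta)

lemma jacobi_step_interior: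
  "jacobi_step P c U W \<Longrightarrow> (i, j) \<in> mesh_interior P \<Longrightarrow> implicit_op P c W \<alpha> i j = explicit_op P c U \<alpha> i j"
  unfolding jacobi_step_iff by blast

lemma jacobi_step_boundary:
  "jacobi_step P c U W \<Longrightarrow> (i, j) \<in> mesh_boundary P \<Longrightarrow> W \<alpha> i j = bdry_mesh P \<alpha> i j"
  unfolding jacobi_step_iff by blast

text \<open>The \<open>c\<close> terms cancel when both operators act on the same function. Hence
  solutions of the scheme are exactly the fixed points of the Jacobi step.\<close>

lemma scheme_lhs_split:
  "scheme_lhs P U \<alpha> i j = implicit_op P c U \<alpha> i j - explicit_op P c U \<alpha> i j"
  unfolding scheme_lhs_def diff_op_def implicit_op_def explicit_op_def
    l_coef_def r_coef_def b_coef_def t_coef_def d_coef_def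
  by (simp add: algebra_simps add_divide_distrib diff_divide_distrib)

lemma scheme_solution_iff_fixpoint: "scheme_solution P U \<longleftrightarrow> jacobi_step P c U U"
  unfolding scheme_solution_def jacobi_step_iff scheme_lhs_split[where c = c] by simp

lemma mesh_le_on_refl: "mesh_le_on M U U"
  by (simp add: mesh_le_on_def)

lemma mesh_le_on_trans: "mesh_le_on M U V \<Longrightarrow> mesh_le_on M V W \<Longrightarrow> mesh_le_on M U W"
  unfolding mesh_le_on_def split_beta by (meson order_trans)

lemma mesh_le_onD: "mesh_le_on M U V \<Longrightarrow> (i, j) \<in> M \<Longrightarrow> U \<alpha> i j \<le> V \<alpha> i j"
  by (auto simp: mesh_le_on_def)

lemma mesh_interior_iff:
  "(i, j) \<in> mesh_interior P \<longleftrightarrow> 0 < i \<and> i < Nx P \<and> 0 < j \<and> j < Ny P"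
  by (auto simp: mesh_interior_def)

lemma mesh_iff: "(i, j) \<in> mesh P \<longleftrightarrow> i \<le> Nx P \<and> j \<le> Ny P"
  by (auto simp: mesh_def)

lemma mesh_boundary_iff:
  "(i, j) \<in> mesh_boundary P \<longleftrightarrow> i \<le> Nx P \<and> j \<le> Ny P \<and> (i = 0 \<or> i = Nx P \<or> j = 0 \<or> j = Ny P)"
  by (auto simp: mesh_boundary_def mesh_iff mesh_interior_iff)

section \<open>Translation of the block equations into mesh point equations\<close>

lemma A_mat_mult_index:
  assumes "z \<in> carrier_vec (Ny P - 1)" and "k < Ny P - 1"
  shows "vec_index (A_mat P \<alpha> i *\<^sub>v z) k = d_coef P \<alpha> i (k + 1) * vec_index z k
    - (if k = 0 then 0 else b_coef P \<alpha> i (k + 1) * vec_index z (k - 1))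
    - (if k + 1 = Ny P - 1 then 0 else t_coef P \<alpha> i (k + 1) * vec_index z (k + 1))"
proof -
  let ?n = "Ny P - 1"
  have "vec_index (A_mat P \<alpha> i *\<^sub>v z) k = (\<Sum>m = 0..<?n.
      (if m = k then d_coef P \<alpha> i (k + 1)
       else if m + 1 = k then - b_coef P \<alpha> i (k + 1)
       else if m = k + 1 then - t_coef P \<alpha> i (k + 1) else 0) * vec_index z m)"
    using assms by (simp add: A_mat_def scalar_prod_def)
  \<comment> \<open>The row is split into three single-entry sums. For \<open>k = 0\<close>
    truncated subtraction makes \<open>k - 1\<close> equal to \<open>k\<close>, hence the inner
    guard; in the last row \<open>k + 1\<close> falls outside the range of summation.\<close>
  also have "\<dots> = (\<Sum>m = 0..<?n.
      (if m = k then d_coef P \<alpha> i (k + 1) * vec_index z k else 0)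
      - (if m = k - 1 then if k = 0 then 0 else b_coef P \<alpha> i (k + 1) * vec_index z (k - 1) else 0)
      - (if m = k + 1 then t_coef P \<alpha> i (k + 1) * vec_index z (k + 1) else 0))"
    by (rule sum.cong) auto
  also have "\<dots> = d_coef P \<alpha> i (k + 1) * vec_index z k
    - (if k = 0 then 0 else b_coef P \<alpha> i (k + 1) * vec_index z (k - 1))
    - (if k + 1 = ?n then 0 else t_coef P \<alpha> i (k + 1) * vec_index z (k + 1))"
    using assms by (auto simp: sum_subtractf)
  finally show ?thesis .
qed

lemma mat_diag_mult_index:
  fixes z :: "real Matrix.vec"
  assumes "z \<in> carrier_vec n" and "k < n"
  shows "vec_index (mat_diag n f *\<^sub>v z) k = f k * vec_index z k"
proof -
  have "vec_index (mat_diag n f *\<^sub>v z) k = (\<Sum>m = 0..<n. (if k = m then f m else 0) * vec_index z m)"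
    using assms by (simp add: mat_diag_def scalar_prod_def)
  also have "\<dots> = (\<Sum>m = 0..<n. if m = k then f k * vec_index z k else 0)"
    by (rule sum.cong) auto
  finally show ?thesis
    using assms by simp
qed

lemma line_carrier: "line P V i \<in> carrier_vec (Ny P - 1)"
  by (simp add: line_def)

lemma dim_line [simp]: "dim_vec (line P V i) = Ny P - 1"
  by (simp add: line_def)

lemma line_index [simp]: "k < Ny P - 1 \<Longrightarrow> vec_index (line P V i) k = V i (k + 1)"
  by (simp add: line_def)

lemma all_inner_index_iff: "(\<forall>j. 0 < j \<and> j < N \<longrightarrow> Q j) \<longleftrightarrow> (\<forall>k<N - 1. Q (k + 1))" for N :: nat
proof
  assume *: "\<forall>k<N - 1. Q (k + 1)"
  show "\<forall>j. 0 < j \<and> j < N \<longrightarrow> Q j"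
  proof (intro allI impI)
    fix j assume "0 < j \<and> j < N"
    then show "Q j"
      using *[rule_format, of "j - 1"] by (simp add: diff_less_mono)
  qed
qed auto

lemma line_le_iff: "line P V i \<le> line P V' i \<longleftrightarrow> (\<forall>j. 0 < j \<and> j < Ny P \<longrightarrow> V i j \<le> V' i j)"
  unfolding all_inner_index_iff by (auto simp: less_eq_vec_def)

lemma line_eq_iff: "line P V i = line P V' i \<longleftrightarrow> (\<forall>j. 0 < j \<and> j < Ny P \<longrightarrow> V i j = V' i j)"
  unfolding all_inner_index_iff by (auto simp: Matrix.vec_eq_iff)

text \<open>Since \<open>z\<close> is the increment from \<open>U\<close> to \<open>W\<close>, the
  part \<open>A U\<close> of the residual turns \<open>A z\<close> into \<open>A W\<close>, and
  \<open>C z\<close> leaves \<open>c * U\<close> on the explicit side. The residual sees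
  \<open>g\<close> rather than \<open>U\<close> on the lines \<open>y = 0\<close> and
  \<open>y = 1\<close>, so only \<open>W\<close> has to match the boundary data, which covers the
  first step as well.\<close>

lemma block_equation_iff:
  assumes "Ny P \<ge> 1"
    and W: "W \<alpha> i 0 = bdry_mesh P \<alpha> i 0" "W \<alpha> i (Ny P) = bdry_mesh P \<alpha> i (Ny P)"
    and z: "z = line P (W \<alpha>) i - line P (U \<alpha>) i"
  shows "A_mat P \<alpha> i *\<^sub>v z + C_mat P c \<alpha> i *\<^sub>v z = - residual P \<alpha> i U \<longleftrightarrow>
    (\<forall>j. 0 < j \<and> j < Ny P \<longrightarrow> implicit_op P c W \<alpha> i j = explicit_op P c U \<alpha> i j)"
    (is "?lhs = - ?res \<longleftrightarrow> _")
proof -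
  have ypt: "ypt P 0 = 0" "ypt P (Ny P) = 1"
    using \<open>Ny P \<ge> 1\<close> by (simp_all add: ypt_def hy_def)
  have zc: "z \<in> carrier_vec (Ny P - 1)"
    unfolding z by (intro minus_carrier_vec line_carrier)
  have dims: "dim_vec ?lhs = Ny P - 1" "dim_vec ?res = Ny P - 1"
    by (simp_all add: A_mat_def C_mat_def residual_def G_vec_def mat_diag_def)
  have dA: "dim_row (A_mat P \<alpha> i) = Ny P - 1" "dim_row (C_mat P c \<alpha> i) = Ny P - 1"
    "dim_row (L_mat P \<alpha> i) = Ny P - 1" "dim_row (R_mat P \<alpha> i) = Ny P - 1"
    by (simp_all add: A_mat_def C_mat_def L_mat_def R_mat_def mat_diag_def)
  have entry: "vec_index ?lhs k + vec_index ?res k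
      = implicit_op P c W \<alpha> i (k + 1) - explicit_op P c U \<alpha> i (k + 1)"
    if k: "k < Ny P - 1" for k
  proof -
    have C_mult: "vec_index (C_mat P c \<alpha> i *\<^sub>v x) k = c \<alpha> i (k + 1) * vec_index x k"
      and L_mult: "vec_index (L_mat P \<alpha> i *\<^sub>v x) k = l_coef P \<alpha> i (k + 1) * vec_index x k"
      and R_mult: "vec_index (R_mat P \<alpha> i *\<^sub>v x) k = r_coef P \<alpha> i (k + 1) * vec_index x k"
      if "x \<in> carrier_vec (Ny P - 1)" for x
      unfolding C_mat_def L_mat_def R_mat_def using that k by (rule mat_diag_mult_index)+
    have zk: "m < Ny P - 1 \<Longrightarrow> vec_index z m = W \<alpha> i (m + 1) - U \<alpha> i (m + 1)" for m
      unfolding z by simp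
    have "vec_index ?lhs k = vec_index (A_mat P \<alpha> i *\<^sub>v z) k
        + c \<alpha> i (k + 1) * (W \<alpha> i (k + 1) - U \<alpha> i (k + 1))"
      using k by (simp add: dA C_mult[OF zc] zk del: index_mult_mat_vec)
    moreover have "vec_index ?res k = vec_index (A_mat P \<alpha> i *\<^sub>v line P (U \<alpha>) i) k
        - l_coef P \<alpha> i (k + 1) * U \<alpha> (i - 1) (k + 1) - r_coef P \<alpha> i (k + 1) * U \<alpha> (i + 1) (k + 1)
        + react P \<alpha> (xpt P i) (ypt P (k + 1)) (at_pt U i (k + 1)) - vec_index (G_vec P \<alpha> i) k"
      using k by (simp add: residual_def dA F_vec_def G_vec_def
          L_mult[OF line_carrier] R_mult[OF line_carrier] del: index_mult_mat_vec)
    moreover have "vec_index (A_mat P \<alpha> i *\<^sub>v z) k + vec_index (A_mat P \<alpha> i *\<^sub>v line P (U \<alpha>) i) k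
        - vec_index (G_vec P \<alpha> i) k
      = d_coef P \<alpha> i (k + 1) * W \<alpha> i (k + 1)
        - b_coef P \<alpha> i (k + 1) * W \<alpha> i k - t_coef P \<alpha> i (k + 1) * W \<alpha> i (k + 2)"
    proof -
      \<comment> \<open>In the first and last rows \<open>G_vec\<close> supplies the neighbour terms
        missing from the matrix product; for \<open>Ny = 2\<close> both cases meet in the single
        row.\<close>
      have last: "k + 2 = Ny P" if "k + 1 = Ny P - 1"
        using that by simp
      have "vec_index (G_vec P \<alpha> i) k = (if k = 0 then b_coef P \<alpha> i (k + 1) * W \<alpha> i k else 0)
          + (if k + 1 = Ny P - 1 then t_coef P \<alpha> i (k + 1) * W \<alpha> i (k + 2) else 0)"
        using k W last by (auto simp: G_vec_def bdry_mesh_def ypt)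
      then show ?thesis
        using k unfolding A_mat_mult_index[OF zc k] A_mat_mult_index[OF line_carrier k]
        by (auto simp: zk algebra_simps)
    qed
    ultimately show ?thesis
      by (simp add: implicit_op_def explicit_op_def algebra_simps)
  qed
  have "?lhs = - ?res \<longleftrightarrow> (\<forall>k<Ny P - 1. vec_index ?lhs k + vec_index ?res k = 0)"
    by (auto simp: Matrix.vec_eq_iff dims dA eq_neg_iff_add_eq_0)
  also have "\<dots> \<longleftrightarrow> (\<forall>k<Ny P - 1. implicit_op P c W \<alpha> i (k + 1) = explicit_op P c U \<alpha> i (k + 1))"
    using entry by simp
  also have "\<dots> \<longleftrightarrow> (\<forall>j. 0 < j \<and> j < Ny P \<longrightarrow> implicit_op P c W \<alpha> i j = explicit_op P c U \<alpha> i j)"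
    by (rule all_inner_index_iff[symmetric])
  finally show ?thesis .
qed

text \<open>The corrections \<open>Z\<close> are determined by consecutive iterates and can be
  eliminated. This leaves a pure recursion, to which the comparison argument applies.\<close>

lemma block_jacobi_iff:
  assumes N: "Nx P \<ge> 1" "Ny P \<ge> 1"
  shows "block_jacobi P c U0 W \<longleftrightarrow> (\<forall>\<alpha>. \<forall>(i, j)\<in>mesh P. W 0 \<alpha> i j = U0 \<alpha> i j) \<and>
    (\<forall>n. jacobi_step P c (W n) (W (Suc n)))" (is "_ \<longleftrightarrow> ?init \<and> ?steps")
proof
  assume jac: "block_jacobi P c U0 W"
  then have ?init
    unfolding block_jacobi_def by (rule conjunct1)
  have ends: "W n \<alpha> i j = bdry_mesh P \<alpha> i j" if "n \<ge> 1" "i \<le> Nx P" "j = 0 \<or> j = Ny P" for n \<alpha> i j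
    using jac[unfolded block_jacobi_def, THEN conjunct2, THEN conjunct2] that by auto
  from jac obtain Z :: "nat \<Rightarrow> 2 \<Rightarrow> nat \<Rightarrow> real Matrix.vec" where Z: "\<forall>n\<ge>1. \<forall>\<alpha>.
      (\<forall>i\<le>Nx P. Z n \<alpha> i \<in> carrier_vec (Ny P - 1) \<and>
         line P (W n \<alpha>) i = line P (W (n - 1) \<alpha>) i + Z n \<alpha> i) \<and>
      (\<forall>i\<in>{1..Nx P - 1}.
         A_mat P \<alpha> i *\<^sub>v Z n \<alpha> i + C_mat P c \<alpha> i *\<^sub>v Z n \<alpha> i = - residual P \<alpha> i (W (n - 1))) \<and>
      (\<forall>i\<in>{0, Nx P}.
         Z n \<alpha> i = (if n = 1 then line P (bdry_mesh P \<alpha>) i - line P (W 0 \<alpha>) i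
                     else 0\<^sub>v (Ny P - 1)))"
    unfolding block_jacobi_def by (elim conjE exE) (rule that)
  have Zc: "Z (Suc n) \<alpha> i \<in> carrier_vec (Ny P - 1)"
    and W_Suc: "line P (W (Suc n) \<alpha>) i = line P (W n \<alpha>) i + Z (Suc n) \<alpha> i"
    if "i \<le> Nx P" for n \<alpha> i
    using Z[rule_format, of "Suc n" \<alpha>] that by simp_all
  have Z_eq: "Z (Suc n) \<alpha> i = line P (W (Suc n) \<alpha>) i - line P (W n \<alpha>) i" if "i \<le> Nx P" for n \<alpha> i
    unfolding W_Suc[OF that] using Zc[OF that, of n \<alpha>] by (intro eq_vecI) auto
  \<comment> \<open>The first correction moves the side lines onto the boundary data; all later
    corrections vanish there.\<close>
  have sides: "line P (W (Suc n) \<alpha>) i = line P (bdry_mesh P \<alpha>) i" if i: "i = 0 \<or> i = Nx P" for n \<alpha> i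
  proof (induction n)
    case 0
    have "Z (Suc 0) \<alpha> i = line P (bdry_mesh P \<alpha>) i - line P (W 0 \<alpha>) i"
      using Z[rule_format, of "Suc 0" \<alpha>] i by auto
    then have "line P (W (Suc 0) \<alpha>) i
        = line P (W 0 \<alpha>) i + (line P (bdry_mesh P \<alpha>) i - line P (W 0 \<alpha>) i)"
      using W_Suc[of i 0 \<alpha>] i by auto
    then show ?case
      by (auto simp: Matrix.vec_eq_iff)
  next
    case (Suc n)
    have "Z (Suc (Suc n)) \<alpha> i = 0\<^sub>v (Ny P - 1)"
      using Z[rule_format, of "Suc (Suc n)" \<alpha>] i by auto
    then show ?case
      using W_Suc[of i "Suc n" \<alpha>] i Suc by auto
  qed
  have "jacobi_step P c (W n) (W (Suc n))" for n
    unfolding jacobi_step_iff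
  proof (intro conjI allI ballI; clarify)
    fix \<alpha> i j assume ij: "(i, j) \<in> mesh_interior P"
    then have "A_mat P \<alpha> i *\<^sub>v Z (Suc n) \<alpha> i + C_mat P c \<alpha> i *\<^sub>v Z (Suc n) \<alpha> i = - residual P \<alpha> i (W n)"
      using Z[rule_format, of "Suc n" \<alpha>] by (auto simp: mesh_interior_def)
    then show "implicit_op P c (W (Suc n)) \<alpha> i j = explicit_op P c (W n) \<alpha> i j"
      using ij block_equation_iff[of P "W (Suc n)" \<alpha> i "Z (Suc n) \<alpha> i" "W n" c] N Z_eq[of i n \<alpha>]
      by (auto simp: mesh_interior_iff ends)
  next
    fix \<alpha> i j assume ij: "(i, j) \<in> mesh_boundary P"
    show "W (Suc n) \<alpha> i j = bdry_mesh P \<alpha> i j"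
    proof (cases "j = 0 \<or> j = Ny P")
      case True
      then show ?thesis
        using ends[of "Suc n" i j \<alpha>] ij by (simp add: mesh_boundary_iff)
    next
      case False
      then have "i = 0 \<or> i = Nx P" "0 < j" "j < Ny P"
        using ij by (auto simp: mesh_boundary_iff)
      then show ?thesis
        using sides[of i n \<alpha>] by (simp add: line_eq_iff)
    qed
  qed
  with \<open>?init\<close> show "?init \<and> ?steps"
    by simp
next
  assume *: "?init \<and> ?steps"
  \<comment> \<open>For the converse the corrections are recovered as differences of consecutive
    iterates.\<close>
  define Z where "Z = (\<lambda>n \<alpha> i. line P (W n \<alpha>) i - line P (W (n - 1) \<alpha>) i)"
  have bd: "W n \<alpha> i j = bdry_mesh P \<alpha> i j" if "n \<ge> 1" "(i, j) \<in> mesh_boundary P" for n \<alpha> i j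
    using *[THEN conjunct2, rule_format, THEN jacobi_step_boundary, OF that(2), of "n - 1"] that(1)
    by simp
  have sides: "line P (W n \<alpha>) i = line P (bdry_mesh P \<alpha>) i" if "n \<ge> 1" "i = 0 \<or> i = Nx P" for n \<alpha> i
    using that by (auto simp: line_eq_iff intro!: bd simp: mesh_boundary_iff)
  have Z_carrier: "Z n \<alpha> i \<in> carrier_vec (Ny P - 1)" for n \<alpha> i
    unfolding Z_def by (intro minus_carrier_vec line_carrier)
  have Z_add: "line P (W n \<alpha>) i = line P (W (n - 1) \<alpha>) i + Z n \<alpha> i" for n \<alpha> i
    by (auto simp: Z_def Matrix.vec_eq_iff)
  have Z_eq: "A_mat P \<alpha> i *\<^sub>v Z n \<alpha> i + C_mat P c \<alpha> i *\<^sub>v Z n \<alpha> i = - residual P \<alpha> i (W (n - 1))"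
    if n: "n \<ge> 1" and i: "i \<in> {1..Nx P - 1}" for n \<alpha> i
  proof -
    have "jacobi_step P c (W (n - 1)) (W n)"
      using *[THEN conjunct2, rule_format, of "n - 1"] n by simp
    then show ?thesis
      using i n N(2) by (subst block_equation_iff[of P "W n" \<alpha> i _ "W (n - 1)" c])
        (auto simp: Z_def mesh_interior_iff mesh_boundary_iff intro!: bd jacobi_step_interior)
  qed
  have Z_side: "Z n \<alpha> i = (if n = 1 then line P (bdry_mesh P \<alpha>) i - line P (W 0 \<alpha>) i else 0\<^sub>v (Ny P - 1))"
    if n: "n \<ge> 1" and i: "i \<in> {0, Nx P}" for n \<alpha> i
  proof (cases "n = 1")
    case True
    then show ?thesis
      using sides[of 1 i \<alpha>] i by (auto simp: Z_def)
  next
    case False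
    then show ?thesis
      using sides[of n i \<alpha>] sides[of "n - 1" i \<alpha>] i n by (auto simp: Z_def)
  qed
  have ends: "W n \<alpha> i j = bdry_mesh P \<alpha> i j" if "n \<ge> 1" "i \<le> Nx P" "j \<in> {0, Ny P}" for n \<alpha> i j
    using that by (intro bd) (auto simp: mesh_boundary_iff)
  show "block_jacobi P c U0 W"
    unfolding block_jacobi_def
  proof (intro conjI exI[of _ Z] allI impI ballI)
    show "Z n \<alpha> i = (if n = 1 then line P (bdry_mesh P \<alpha>) i - line P (W 0 \<alpha>) i else 0\<^sub>v (Ny P - 1))"
      if "n \<ge> 1" "i \<in> {0, Nx P}" for n \<alpha> i
      using that by (rule Z_side)
  qed (use * Z_carrier Z_add Z_eq ends in blast)+
qed

lemma block_jacobi_initial: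
  assumes "block_jacobi P c U0 W"
  shows "mesh_le_on (mesh P) (W 0) U0" "mesh_le_on (mesh P) U0 (W 0)"
proof -
  have "W 0 \<alpha> i j = U0 \<alpha> i j" if "(i, j) \<in> mesh P" for \<alpha> i j
    using assms[unfolded block_jacobi_def, THEN conjunct1] that by blast
  then show "mesh_le_on (mesh P) (W 0) U0" "mesh_le_on (mesh P) U0 (W 0)"
    by (auto simp: mesh_le_on_def)
qed

section \<open>Monotone iteration\<close>

text \<open>Collects what the iteration uses. The derivative bounds appear as the one-sided
  Lipschitz estimate \<open>react_increment\<close> for ordered pairs in the sector, smoothness of
  the reaction as continuity in \<open>u\<close>.\<close>

locale monotone_scheme =
  fixes P :: problem and c Ut Uh :: mesh_fun
  assumes Nx_pos: "Nx P \<ge> 1" and Ny_pos: "Ny P \<ge> 1"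
    and eps_pos: "\<And>\<alpha>. eps P \<alpha> > 0"
    and vel_nonneg: "\<And>\<alpha> i j. (i, j) \<in> mesh P \<Longrightarrow> vel P \<alpha> (xpt P i) (ypt P j) \<ge> 0"
    and c_nonneg: "\<And>\<alpha> i j. (i, j) \<in> mesh P \<Longrightarrow> c \<alpha> i j \<ge> 0"
    and ordered: "ordered_upper_lower P Ut Uh"
    and react_continuous: "\<And>\<alpha> i j u. (i, j) \<in> mesh P \<Longrightarrow> isCont (react P \<alpha> (xpt P i) (ypt P j)) u"
    and react_increment: "\<And>\<alpha> i j U V. (i, j) \<in> mesh P \<Longrightarrow> U \<in> sector P Uh Ut \<Longrightarrow>
      V \<in> sector P Uh Ut \<Longrightarrow> mesh_le_on (mesh P) U V \<Longrightarrow>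
      react P \<alpha> (xpt P i) (ypt P j) (at_pt V i j) - react P \<alpha> (xpt P i) (ypt P j) (at_pt U i j)
        \<le> c \<alpha> i j * (V \<alpha> i j - U \<alpha> i j)"
begin

section \<open>Inverse monotonicity and the comparison principle\<close>

lemma hx_pos: "hx P > 0" and hy_pos: "hy P > 0"
  using Nx_pos Ny_pos by (simp_all add: hx_def hy_def)

lemma coef_signs:
  assumes "(i, j) \<in> mesh P"
  shows "l_coef P \<alpha> i j > 0" "r_coef P \<alpha> i j > 0" "b_coef P \<alpha> i j > 0" "t_coef P \<alpha> i j > 0"
  using eps_pos[of \<alpha>] vel_nonneg[OF assms, of \<alpha>] hx_pos hy_pos
  by (auto simp: l_coef_def r_coef_def b_coef_def t_coef_def intro!: add_pos_nonneg)

text \<open>The excess on the diagonal is \<open>l + r + c\<close>: the couplings in the x-direction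
  are counted in \<open>d_coef\<close> but treated explicitly.\<close>

lemma diagonal_dominant:
  assumes "(i, j) \<in> mesh P"
  shows "b_coef P \<alpha> i j + t_coef P \<alpha> i j < d_coef P \<alpha> i j + c \<alpha> i j"
  using coef_signs[OF assms, of \<alpha>] c_nonneg[OF assms, of \<alpha>] by (simp add: d_coef_def)

text \<open>The term \<open>c * U\<close> compensates the growth of the reaction by
  \<open>react_increment\<close>, and the neighbouring lines enter with positive weights.\<close>

lemma explicit_op_mono:
  assumes "U \<in> sector P Uh Ut" "U' \<in> sector P Uh Ut" "mesh_le_on (mesh P) U U'"
    and ij: "(i, j) \<in> mesh_interior P"
  shows "explicit_op P c U \<alpha> i j \<le> explicit_op P c U' \<alpha> i j"
proof -
  have mem: "(i, j) \<in> mesh P" "(i - 1, j) \<in> mesh P" "(i + 1, j) \<in> mesh P"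
    using ij by (auto simp: mesh_interior_iff mesh_iff)
  have "l_coef P \<alpha> i j * U \<alpha> (i - 1) j \<le> l_coef P \<alpha> i j * U' \<alpha> (i - 1) j"
    "r_coef P \<alpha> i j * U \<alpha> (i + 1) j \<le> r_coef P \<alpha> i j * U' \<alpha> (i + 1) j"
    using coef_signs[OF mem(1), of \<alpha>] mesh_le_onD[OF assms(3)] mem by simp_all
  then show ?thesis
    using react_increment[OF mem(1) assms(1-3), of \<alpha>] by (simp add: explicit_op_def algebra_simps)
qed

text \<open>The operator couples points only along \<open>j\<close>, so each inner line is handled
  separately by the tridiagonal minimum principle; the side lines consist of boundary
  points.\<close>

lemma implicit_op_nonneg:
  assumes interior: "\<And>i j. (i, j) \<in> mesh_interior P \<Longrightarrow> implicit_op P c W \<alpha> i j \<ge> 0"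
    and boundary: "\<And>i j. (i, j) \<in> mesh_boundary P \<Longrightarrow> W \<alpha> i j \<ge> 0"
    and ij: "(i, j) \<in> mesh P"
  shows "W \<alpha> i j \<ge> 0"
proof (cases "i = 0 \<or> i = Nx P")
  case True
  then show ?thesis
    using ij by (intro boundary) (auto simp: mesh_iff mesh_boundary_iff)
next
  case False
  then have i: "0 < i" "i < Nx P"
    using ij by (auto simp: mesh_iff)
  show ?thesis
  proof (rule tridiag_nonneg[where V = "W \<alpha> i" and N = "Ny P" and a = "\<lambda>j. d_coef P \<alpha> i j + c \<alpha> i j"
        and b = "b_coef P \<alpha> i" and t = "t_coef P \<alpha> i"])
    show "W \<alpha> i 0 \<ge> 0" "W \<alpha> i (Ny P) \<ge> 0"
      using i by (auto intro!: boundary simp: mesh_boundary_iff)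
    show "j \<le> Ny P"
      using ij by (simp add: mesh_iff)
  next
    fix k assume k: "0 < k" "k < Ny P"
    then have mem: "(i, k) \<in> mesh_interior P" "(i, k) \<in> mesh P"
      using i by (auto simp: mesh_interior_iff mesh_iff)
    show "0 \<le> b_coef P \<alpha> i k \<and> 0 \<le> t_coef P \<alpha> i k \<and>
        b_coef P \<alpha> i k + t_coef P \<alpha> i k < d_coef P \<alpha> i k + c \<alpha> i k"
      using coef_signs[OF mem(2), of \<alpha>] diagonal_dominant[OF mem(2), of \<alpha>] by simp
    show "0 \<le> (d_coef P \<alpha> i k + c \<alpha> i k) * W \<alpha> i k - b_coef P \<alpha> i k * W \<alpha> i (k - 1)
        - t_coef P \<alpha> i k * W \<alpha> i (k + 1)"
      using interior[OF mem(1)] by (simp add: implicit_op_def)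
  qed
qed

text \<open>In the interior \<open>M W \<le> T U \<le> T U' \<le> M W'\<close>, on the boundary
  \<open>W \<le> g \<le> W'\<close>. Linearity of \<open>M\<close> lets inverse monotonicity act on
  the difference \<open>W' - W\<close>.\<close>

lemma comparison:
  assumes sec: "U \<in> sector P Uh Ut" "U' \<in> sector P Uh Ut" and le: "mesh_le_on (mesh P) U U'"
    and sub: "sub_step P c U W" and super: "super_step P c U' W'"
  shows "mesh_le_on (mesh P) W W'"
  unfolding mesh_le_on_def
proof (intro allI ballI; clarify)
  fix \<alpha> i j assume ij: "(i, j) \<in> mesh P"
  define D where "D = (\<lambda>\<alpha> i j. W' \<alpha> i j - W \<alpha> i j)"
  have "D \<alpha> i j \<ge> 0"
  proof (rule implicit_op_nonneg[OF _ _ ij])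
    fix i j assume "(i, j) \<in> mesh_interior P"
    then have "implicit_op P c W \<alpha> i j \<le> implicit_op P c W' \<alpha> i j"
      using explicit_op_mono[OF sec le, of i j \<alpha>] sub super
      unfolding sub_step_def super_step_def by (meson mesh_le_onD order_trans)
    then show "implicit_op P c D \<alpha> i j \<ge> 0"
      by (simp add: implicit_op_def D_def algebra_simps)
  next
    fix i j assume "(i, j) \<in> mesh_boundary P"
    then show "D \<alpha> i j \<ge> 0"
      using sub super unfolding sub_step_def super_step_def D_def
      by (meson diff_ge_0_iff_ge mesh_le_onD order_trans)
  qed
  then show "W \<alpha> i j \<le> W' \<alpha> i j"
    by (simp add: D_def)
qed

section \<open>Existence of Jacobi iterates\<close>

lemma jacobi_step_exists: "\<exists>W. jacobi_step P c U W"
proof -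
  \<comment> \<open>The lines decouple, and each is a two-point problem in \<open>j\<close> covered
    by \<open>tridiag_solvable\<close>.\<close>
  define solves where "solves \<alpha> i V \<longleftrightarrow> V 0 = bdry_mesh P \<alpha> i 0 \<and>
      V (Ny P) = bdry_mesh P \<alpha> i (Ny P) \<and> (\<forall>j. 0 < j \<and> j < Ny P \<longrightarrow>
        (d_coef P \<alpha> i j + c \<alpha> i j) * V j - b_coef P \<alpha> i j * V (j - 1)
          - t_coef P \<alpha> i j * V (j + 1) = explicit_op P c U \<alpha> i j)" for \<alpha> i V
  have "\<exists>V. solves \<alpha> i V" if "i \<le> Nx P" for \<alpha> i
  proof -
    have coef: "0 \<le> b_coef P \<alpha> i j \<and> 0 < t_coef P \<alpha> i j \<and>
        b_coef P \<alpha> i j + t_coef P \<alpha> i j < d_coef P \<alpha> i j + c \<alpha> i j" if "j < Ny P" for j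
      using coef_signs[of i j \<alpha>] diagonal_dominant[of i j \<alpha>] that \<open>i \<le> Nx P\<close> by (simp add: mesh_iff)
    show ?thesis
      by (rule tridiag_solvable[OF Ny_pos, where b = "b_coef P \<alpha> i" and t = "t_coef P \<alpha> i"
            and a = "\<lambda>j. d_coef P \<alpha> i j + c \<alpha> i j" and q = "explicit_op P c U \<alpha> i"
            and ?v0.0 = "bdry_mesh P \<alpha> i 0" and vN = "bdry_mesh P \<alpha> i (Ny P)"])
        (use coef in \<open>auto simp: solves_def\<close>)
  qed
  then have "solves \<alpha> i (SOME V. solves \<alpha> i V)" if "i \<le> Nx P" for \<alpha> i
    using that by (metis someI_ex)
  then obtain V where "i \<le> Nx P \<Longrightarrow> solves \<alpha> i (V \<alpha> i)" for \<alpha> i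
    by (rule that)
  note V = this[unfolded solves_def, simplified]
  \<comment> \<open>On the side lines the tridiagonal solution is replaced by the boundary data;
    inner equations involve new values of their own line only.\<close>
  define W where "W = (\<lambda>\<alpha> i. if i = 0 \<or> i = Nx P then bdry_mesh P \<alpha> i else V \<alpha> i)"
  have "jacobi_step P c U W"
    unfolding jacobi_step_iff
    by (auto simp: W_def V mesh_interior_iff mesh_boundary_iff implicit_op_def)
  then show ?thesis
    by blast
qed

lemma block_jacobi_step: "block_jacobi P c U0 W \<Longrightarrow> jacobi_step P c (W n) (W (Suc n))"
  unfolding block_jacobi_iff[OF Nx_pos Ny_pos] by blast

lemma block_jacobi_exists: "\<exists>W. block_jacobi P c U0 W"
proof -
  obtain s where s: "\<And>U. jacobi_step P c U (s U)"
    using jacobi_step_exists by metis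
  have "block_jacobi P c U0 (\<lambda>n. (s ^^ n) U0)"
    unfolding block_jacobi_iff[OF Nx_pos Ny_pos] by (simp add: s)
  then show ?thesis
    by blast
qed

section \<open>Monotonicity of the upper and lower sequences\<close>

lemma Ut_in_sector: "Ut \<in> sector P Uh Ut" and Uh_in_sector: "Uh \<in> sector P Uh Ut"
  using ordered by (auto simp: sector_def ordered_upper_lower_def mesh_le_on_refl)

text \<open>The scheme is \<open>M U - T U\<close>, so an upper solution is a super-step from itself
  and a lower solution a sub-step. They act as barriers for the iterates.\<close>

lemma super_step_Ut: "super_step P c Ut Ut" and sub_step_Uh: "sub_step P c Uh Uh"
  using ordered unfolding ordered_upper_lower_def super_step_def sub_step_def
  by (auto simp: mesh_le_on_def scheme_lhs_split[where c = c])

lemma sector_between: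
  assumes "U \<in> sector P Uh Ut" "V \<in> sector P Uh Ut" "mesh_le_on (mesh P) U W" "mesh_le_on (mesh P) W V"
  shows "W \<in> sector P Uh Ut"
  using assms unfolding sector_def by (auto intro: mesh_le_on_trans)

text \<open>Sector membership and monotonicity need one joint induction: comparison applies only
  within the sector. The barrier \<open>Uh\<close> bounds the new iterate from below, the previous
  iterate from above, and then consecutive steps can be compared.\<close>

lemma upper_sequence:
  assumes "block_jacobi P c Ut W"
  shows "W n \<in> sector P Uh Ut \<and> mesh_le_on (mesh P) (W (Suc n)) (W n)"
proof (induction n)
  note step = block_jacobi_step[OF assms, unfolded jacobi_step_def]
  note W0 = block_jacobi_initial[OF assms]
  note sec = Ut_in_sector Uh_in_sector
  {
    case 0
    \<comment> \<open>\<open>W 0\<close> agrees with \<open>Ut\<close> at mesh points only, so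
      membership is transferred through inequalities on the mesh.\<close>
    have "W 0 \<in> sector P Uh Ut"
      using W0 sec(1) unfolding sector_def by (auto intro: mesh_le_on_trans)
    moreover have "mesh_le_on (mesh P) (W (Suc 0)) Ut"
      by (rule comparison[OF _ sec(1) W0(1) _ super_step_Ut]) (use calculation step in auto)
    ultimately show ?case
      using W0(2) by (auto intro: mesh_le_on_trans)
  next
    case (Suc n)
    have "mesh_le_on (mesh P) Uh (W n)"
      using Suc by (simp add: sector_def)
    from comparison[OF sec(2) _ this sub_step_Uh]
    have "mesh_le_on (mesh P) Uh (W (Suc n))"
      using Suc step by blast
    then have "W (Suc n) \<in> sector P Uh Ut"
      using Suc sector_between[OF sec(2)] by blast
    moreover have "mesh_le_on (mesh P) (W (Suc (Suc n))) (W (Suc n))"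
      by (rule comparison[where U = "W (Suc n)" and U' = "W n"]) (use calculation Suc step in auto)
    ultimately show ?case ..
  }
qed

text \<open>The mirror image of \<open>upper_sequence\<close>, with \<open>Ut\<close> as the barrier
  from above.\<close>

lemma lower_sequence:
  assumes "block_jacobi P c Uh V"
  shows "V n \<in> sector P Uh Ut \<and> mesh_le_on (mesh P) (V n) (V (Suc n))"
proof (induction n)
  note step = block_jacobi_step[OF assms, unfolded jacobi_step_def]
  note V0 = block_jacobi_initial[OF assms]
  note sec = Ut_in_sector Uh_in_sector
  {
    case 0
    have "V 0 \<in> sector P Uh Ut"
      using V0 sec(2) unfolding sector_def by (auto intro: mesh_le_on_trans)
    moreover have "mesh_le_on (mesh P) Uh (V (Suc 0))"
      by (rule comparison[OF sec(2) _ V0(2) sub_step_Uh]) (use calculation step in auto)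
    ultimately show ?case
      using V0(1) by (auto intro: mesh_le_on_trans)
  next
    case (Suc n)
    have "mesh_le_on (mesh P) (V n) Ut"
      using Suc by (simp add: sector_def)
    from comparison[OF _ sec(1) this _ super_step_Ut]
    have "mesh_le_on (mesh P) (V (Suc n)) Ut"
      using Suc step by blast
    then have "V (Suc n) \<in> sector P Uh Ut"
      using Suc sector_between[OF _ sec(1)] by blast
    moreover have "mesh_le_on (mesh P) (V (Suc n)) (V (Suc (Suc n)))"
      by (rule comparison[where U = "V n" and U' = "V (Suc n)"]) (use calculation Suc step in auto)
    ultimately show ?case ..
  }
qed

section \<open>Ordering of sequences and passage to the limit\<close>

lemma iterates_le:
  assumes X0: "mesh_le_on (mesh P) (X 0) (Y 0)"
    and sec: "\<And>n. X n \<in> sector P Uh Ut" "\<And>n. Y n \<in> sector P Uh Ut"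
    and step: "\<And>n. jacobi_step P c (X n) (X (Suc n))" "\<And>n. jacobi_step P c (Y n) (Y (Suc n))"
  shows "mesh_le_on (mesh P) (X n) (Y n)"
proof (induction n)
  case (Suc n)
  then show ?case
    using comparison[OF sec Suc] step unfolding jacobi_step_def by blast
qed (rule X0)

text \<open>Passes to the limit in \<open>M X(n+1) = T X(n)\<close>: each equation involves finitely
  many mesh values, and the reaction is continuous in \<open>u\<close>. The limit is thus a fixed
  point of the step.\<close>

lemma limit_is_solution:
  assumes step: "\<And>n. jacobi_step P c (X n) (X (Suc n))"
    and lim: "\<And>\<alpha> i j. (i, j) \<in> mesh P \<Longrightarrow> (\<lambda>n. X n \<alpha> i j) \<longlonglongrightarrow> L \<alpha> i j"
  shows "scheme_solution P L"
  unfolding scheme_solution_iff_fixpoint[of P L c] jacobi_step_iff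
proof (intro conjI allI ballI; clarify)
  fix \<alpha> i j assume ij: "(i, j) \<in> mesh_interior P"
  then have mem: "(i, j) \<in> mesh P" "(i - 1, j) \<in> mesh P" "(i + 1, j) \<in> mesh P"
    "(i, j - 1) \<in> mesh P" "(i, j + 1) \<in> mesh P"
    by (auto simp: mesh_interior_iff mesh_iff)
  have "(\<lambda>n. at_pt (X n) i j) \<longlonglongrightarrow> at_pt L i j"
    unfolding at_pt_def by (intro tendsto_vec_lambda lim mem(1))
  then have "(\<lambda>n. react P \<alpha> (xpt P i) (ypt P j) (at_pt (X n) i j))
      \<longlonglongrightarrow> react P \<alpha> (xpt P i) (ypt P j) (at_pt L i j)"
    by (rule isCont_tendsto_compose[OF react_continuous[OF mem(1)]])
  then have "(\<lambda>n. explicit_op P c (X n) \<alpha> i j) \<longlonglongrightarrow> explicit_op P c L \<alpha> i j"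
    unfolding explicit_op_def by (intro tendsto_intros lim mem)
  moreover have "(\<lambda>n. implicit_op P c (X (Suc n)) \<alpha> i j) \<longlonglongrightarrow> implicit_op P c L \<alpha> i j"
    unfolding implicit_op_def by (intro tendsto_intros LIMSEQ_Suc lim mem)
  moreover have "implicit_op P c (X (Suc n)) \<alpha> i j = explicit_op P c (X n) \<alpha> i j" for n
    by (rule jacobi_step_interior[OF step ij])
  ultimately show "implicit_op P c L \<alpha> i j = explicit_op P c L \<alpha> i j"
    using LIMSEQ_unique by auto
next
  fix \<alpha> i j assume ij: "(i, j) \<in> mesh_boundary P"
  \<comment> \<open>The sequence is shifted because the initial iterate may differ from the boundary
    data.\<close>
  then have "(\<lambda>n. X (Suc n) \<alpha> i j) \<longlonglongrightarrow> L \<alpha> i j"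
    by (intro LIMSEQ_Suc lim) (auto simp: mesh_boundary_def)
  moreover have "X (Suc n) \<alpha> i j = bdry_mesh P \<alpha> i j" for n
    by (rule jacobi_step_boundary[OF step ij])
  ultimately show "L \<alpha> i j = bdry_mesh P \<alpha> i j"
    by (simp add: LIMSEQ_const_iff)
qed

lemma monotone_convergence:
  assumes W: "block_jacobi P c Ut W" and V: "block_jacobi P c Uh V"
  obtains Umax Umin where
    "maximal_solution P Uh Ut Umax" "minimal_solution P Uh Ut Umin"
    "\<And>\<alpha> i j. (i, j) \<in> mesh P \<Longrightarrow> (\<lambda>n. W n \<alpha> i j) \<longlonglongrightarrow> Umax \<alpha> i j"
    "\<And>\<alpha> i j. (i, j) \<in> mesh P \<Longrightarrow> (\<lambda>n. V n \<alpha> i j) \<longlonglongrightarrow> Umin \<alpha> i j"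
    "\<And>n. mesh_le_on (mesh P) (V n) (V (Suc n))" "\<And>n. mesh_le_on (mesh P) (V n) Umin"
    "mesh_le_on (mesh P) Umin Umax"
    "\<And>n. mesh_le_on (mesh P) Umax (W n)" "\<And>n. mesh_le_on (mesh P) (W (Suc n)) (W n)"
proof -
  note W_step = block_jacobi_step[OF W]
  note V_step = block_jacobi_step[OF V]
  have W_sec: "W n \<in> sector P Uh Ut" and W_dec: "mesh_le_on (mesh P) (W (Suc n)) (W n)" for n
    using upper_sequence[OF W] by auto
  have V_sec: "V n \<in> sector P Uh Ut" and V_inc: "mesh_le_on (mesh P) (V n) (V (Suc n))" for n
    using lower_sequence[OF V] by auto
  have V0: "mesh_le_on (mesh P) (V 0) S" and W0: "mesh_le_on (mesh P) S (W 0)"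
    if "S \<in> sector P Uh Ut" for S
    using that block_jacobi_initial[OF V] block_jacobi_initial[OF W] unfolding sector_def
    by (auto intro: mesh_le_on_trans)
  \<comment> \<open>At indices outside the mesh the limit need not exist and the value is arbitrary;
    every later claim is restricted to mesh points.\<close>
  define Umax :: mesh_fun where "Umax = (\<lambda>\<alpha> i j. lim (\<lambda>n. W n \<alpha> i j))"
  define Umin :: mesh_fun where "Umin = (\<lambda>\<alpha> i j. lim (\<lambda>n. V n \<alpha> i j))"
  have decs: "decseq (\<lambda>n. W n \<alpha> i j)" and incs: "incseq (\<lambda>n. V n \<alpha> i j)"
    if "(i, j) \<in> mesh P" for \<alpha> i j
    using mesh_le_onD[OF W_dec that] mesh_le_onD[OF V_inc that]
    by (auto intro: decseq_SucI incseq_SucI)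
  have W_lim: "(\<lambda>n. W n \<alpha> i j) \<longlonglongrightarrow> Umax \<alpha> i j" if "(i, j) \<in> mesh P" for \<alpha> i j
  proof -
    have "Uh \<alpha> i j \<le> W n \<alpha> i j" for n
      using W_sec[of n] that by (auto simp: sector_def dest: mesh_le_onD)
    then have "convergent (\<lambda>n. W n \<alpha> i j)"
      using decseq_convergent[OF decs[OF that]] unfolding convergent_def by metis
    then show ?thesis
      unfolding Umax_def by (simp add: convergent_LIMSEQ_iff)
  qed
  have V_lim: "(\<lambda>n. V n \<alpha> i j) \<longlonglongrightarrow> Umin \<alpha> i j" if "(i, j) \<in> mesh P" for \<alpha> i j
  proof -
    have "V n \<alpha> i j \<le> Ut \<alpha> i j" for n
      using V_sec[of n] that by (auto simp: sector_def dest: mesh_le_onD)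
    then have "convergent (\<lambda>n. V n \<alpha> i j)"
      using incseq_convergent[OF incs[OF that]] unfolding convergent_def by metis
    then show ?thesis
      unfolding Umin_def by (simp add: convergent_LIMSEQ_iff)
  qed
  have above: "mesh_le_on (mesh P) Umax (W n)" and below: "mesh_le_on (mesh P) (V n) Umin" for n
    unfolding mesh_le_on_def using decseq_ge[OF decs W_lim] incseq_le[OF incs V_lim] by auto
  have max: "mesh_le_on (mesh P) S Umax" and min: "mesh_le_on (mesh P) Umin S"
    if S: "S \<in> sector P Uh Ut" "scheme_solution P S" for S
  proof -
    \<comment> \<open>A solution generates a constant Jacobi sequence. It starts between the lower
      and upper sequences, so \<open>iterates_le\<close> keeps it between them for every
      \<open>n\<close>.\<close>
    have fix_step: "jacobi_step P c S S"
      using S(2) by (simp add: scheme_solution_iff_fixpoint[of P S c])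
    have SW: "mesh_le_on (mesh P) S (W n)" and VS: "mesh_le_on (mesh P) (V n) S" for n
      using iterates_le[of "\<lambda>_. S" W] iterates_le[of V "\<lambda>_. S"] W0 V0 S(1) W_sec V_sec
        fix_step W_step V_step by auto
    have "S \<alpha> i j \<le> Umax \<alpha> i j \<and> Umin \<alpha> i j \<le> S \<alpha> i j" if "(i, j) \<in> mesh P" for \<alpha> i j
      using LIMSEQ_le_const[OF W_lim[OF that, of \<alpha>]] LIMSEQ_le_const2[OF V_lim[OF that, of \<alpha>]]
        mesh_le_onD[OF SW that] mesh_le_onD[OF VS that] by blast
    then show "mesh_le_on (mesh P) S Umax" "mesh_le_on (mesh P) Umin S"
      by (auto simp: mesh_le_on_def)
  qed
  have VW: "mesh_le_on (mesh P) (V n) (W n)" for n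
    by (rule iterates_le) (use V0 W_sec V_sec W_step V_step in auto)
  have "mesh_le_on (mesh P) Umin Umax"
    using LIMSEQ_le[OF V_lim W_lim] mesh_le_onD[OF VW] by (auto simp: mesh_le_on_def)
  moreover have "scheme_solution P Umax" "scheme_solution P Umin"
    using limit_is_solution[of W Umax] limit_is_solution[of V Umin] W_step V_step W_lim V_lim by auto
  ultimately show thesis
    using max min W_lim V_lim above below W_dec V_inc
    by (intro that[of Umax Umin]) (auto simp: maximal_solution_def minimal_solution_def)
qed

end

section \<open>From the hypotheses on derivatives to the monotone scheme\<close>

lemma grid_point_in_closure:
  assumes "Nx P \<ge> 1" "Ny P \<ge> 1" "(i, j) \<in> mesh P"
  shows "(xpt P i, ypt P j) \<in> closure omega"
  using assms by (simp add: omega_def closure_Times mesh_iff xpt_def ypt_def hx_def hy_def)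

text \<open>The derivative bounds are assumed for mesh functions in the sector, whereas the mean
  value argument needs them at arbitrary vectors of the box over one mesh point. Changing
  \<open>Ut\<close> at that single point connects the two.\<close>

lemma sector_point:
  assumes "mesh_le_on (mesh P) Uh Ut" and "(i, j) \<in> mesh P"
    and "\<And>\<gamma>. at_pt Uh i j $ \<gamma> \<le> u $ \<gamma> \<and> u $ \<gamma> \<le> at_pt Ut i j $ \<gamma>"
  obtains U where "U \<in> sector P Uh Ut" "at_pt U i j = u"
proof
  define U :: mesh_fun where "U = (\<lambda>\<gamma> i' j'. if i' = i \<and> j' = j then u $ \<gamma> else Ut \<gamma> i' j')"
  show "U \<in> sector P Uh Ut"
    using assms by (auto simp: sector_def mesh_le_on_def U_def at_pt_def)
  show "at_pt U i j = u"
    by (simp add: U_def at_pt_def)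
qed

text \<open>\<open>block_jacobi\<close> constrains iterates at mesh points only, so the conclusion
  is stated for all generated sequences; their existence is asserted separately, which keeps it from
  being vacuous.\<close>

theorem theorem2:
  fixes P :: problem and c Ut Uh :: mesh_fun
  assumes "Nx P \<ge> 1" and "Ny P \<ge> 1"
    and "\<And>\<alpha>. eps P \<alpha> > 0"
    and "\<And>\<alpha>. smooth_on (closure omega) (\<lambda>(x, y). vel P \<alpha> x y)"
    and "\<And>\<alpha> x y. (x, y) \<in> closure omega \<Longrightarrow> vel P \<alpha> x y \<ge> 0"
    and "\<And>\<alpha>. smooth_on {(x, y, u). (x, y) \<in> closure omega} (\<lambda>(x, y, u). react P \<alpha> x y u)"
    and "\<And>\<alpha>. smooth_on (frontier omega) (\<lambda>(x, y). bdry P \<alpha> x y)"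
    and "ordered_upper_lower P Ut Uh"
    and "\<And>\<alpha> i j. (i, j) \<in> mesh P \<Longrightarrow> c \<alpha> i j \<ge> 0"
    and "\<And>\<alpha>. bounded ((\<lambda>(i, j). c \<alpha> i j) ` mesh P)"
    and "\<And>U \<alpha> i j. U \<in> sector P Uh Ut \<Longrightarrow> (i, j) \<in> mesh P \<Longrightarrow>
           partial_u \<alpha> (react P \<alpha> (xpt P i) (ypt P j)) (at_pt U i j) \<le> c \<alpha> i j"
    and "\<And>U \<alpha> \<alpha>' i j. U \<in> sector P Uh Ut \<Longrightarrow> (i, j) \<in> mesh P \<Longrightarrow> \<alpha>' \<noteq> \<alpha> \<Longrightarrow>
           - partial_u \<alpha>' (react P \<alpha> (xpt P i) (ypt P j)) (at_pt U i j) \<ge> 0"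
  shows "(\<exists>W. block_jacobi P c Ut W) \<and> (\<exists>V. block_jacobi P c Uh V) \<and>
    (\<forall>W V. block_jacobi P c Ut W \<and> block_jacobi P c Uh V \<longrightarrow>
      (\<exists>Umax Umin.
         maximal_solution P Uh Ut Umax \<and> minimal_solution P Uh Ut Umin \<and>
         (\<forall>\<alpha>. \<forall>(i, j)\<in>mesh P. (\<lambda>n. W n \<alpha> i j) \<longlonglongrightarrow> Umax \<alpha> i j) \<and>
         (\<forall>\<alpha>. \<forall>(i, j)\<in>mesh P. (\<lambda>n. V n \<alpha> i j) \<longlonglongrightarrow> Umin \<alpha> i j) \<and>
         (\<forall>n\<ge>1. \<forall>i\<le>Nx P. \<forall>\<alpha>.
            line P (V (n - 1) \<alpha>) i \<le> line P (V n \<alpha>) i \<and>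
            line P (V n \<alpha>) i \<le> line P (Umin \<alpha>) i \<and>
            line P (Umin \<alpha>) i \<le> line P (Umax \<alpha>) i \<and>
            line P (Umax \<alpha>) i \<le> line P (W n \<alpha>) i \<and>
            line P (W n \<alpha>) i \<le> line P (W (n - 1) \<alpha>) i) \<and>
         (\<forall>S\<in>sector P Uh Ut. scheme_solution P S \<longrightarrow>
            mesh_le_on (mesh P) Umin S \<and> mesh_le_on (mesh P) S Umax)))"
proof -
  have le: "mesh_le_on (mesh P) Uh Ut"
    using assms(8) by (simp add: ordered_upper_lower_def)
  have diff: "react P \<alpha> (xpt P i) (ypt P j) differentiable (at u)" if "(i, j) \<in> mesh P" for \<alpha> i j u
    using smooth_on_slice_differentiable[OF assms(6)] grid_point_in_closure[OF assms(1,2) that] .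
  interpret monotone_scheme P c Ut Uh
  proof
    fix \<alpha> i j assume "(i, j) \<in> mesh P"
    then show "vel P \<alpha> (xpt P i) (ypt P j) \<ge> 0"
      by (intro assms(5) grid_point_in_closure assms(1,2))
  next
    fix \<alpha> i j u assume "(i, j) \<in> mesh P"
    then show "isCont (react P \<alpha> (xpt P i) (ypt P j)) u"
      by (intro differentiable_imp_continuous_within diff)
  next
    fix \<alpha> i j and U V :: mesh_fun
    let ?\<phi> = "react P \<alpha> (xpt P i) (ypt P j)"
    assume ij: "(i, j) \<in> mesh P" and UV: "U \<in> sector P Uh Ut" "V \<in> sector P Uh Ut"
      "mesh_le_on (mesh P) U V"
    have "?\<phi> (at_pt V i j) - ?\<phi> (at_pt U i j) \<le> c \<alpha> i j * (at_pt V i j $ \<alpha> - at_pt U i j $ \<alpha>)"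
    \<comment> \<open>At a fixed mesh point the sector becomes the box between \<open>Uh\<close> and
      \<open>Ut\<close>, and \<open>sector_point\<close> realises each of its vectors by a mesh
      function.\<close>
    proof (rule quasimonotone_increment[where lo = "at_pt Uh i j" and hi = "at_pt Ut i j"])
      show "?\<phi> differentiable (at u)" for u
        by (rule diff[OF ij])
      show "partial_u \<alpha> ?\<phi> u \<le> c \<alpha> i j"
        if "\<And>\<gamma>. at_pt Uh i j $ \<gamma> \<le> u $ \<gamma> \<and> u $ \<gamma> \<le> at_pt Ut i j $ \<gamma>" for u
        using sector_point[OF le ij that] assms(11)[OF _ ij] by metis
      show "partial_u \<beta> ?\<phi> u \<le> 0"
        if "\<beta> \<noteq> \<alpha>" "\<And>\<gamma>. at_pt Uh i j $ \<gamma> \<le> u $ \<gamma> \<and> u $ \<gamma> \<le> at_pt Ut i j $ \<gamma>" for u \<beta>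
        using sector_point[OF le ij that(2)] assms(12)[OF _ ij that(1)] by (metis neg_0_le_iff_le)
      show "at_pt Uh i j $ \<gamma> \<le> at_pt U i j $ \<gamma>" "at_pt U i j $ \<gamma> \<le> at_pt V i j $ \<gamma>"
        "at_pt V i j $ \<gamma> \<le> at_pt Ut i j $ \<gamma>" for \<gamma>
        using UV ij by (auto simp: sector_def at_pt_def dest: mesh_le_onD)
    qed
    then show "?\<phi> (at_pt V i j) - ?\<phi> (at_pt U i j) \<le> c \<alpha> i j * (V \<alpha> i j - U \<alpha> i j)"
      by (simp add: at_pt_def)
  qed (use assms in auto)
  have line_le: "line P (X \<alpha>) i \<le> line P (Y \<alpha>) i"
    if "mesh_le_on (mesh P) X Y" "i \<le> Nx P" for X Y :: mesh_fun and \<alpha> i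
    unfolding line_le_iff using that by (auto simp: mesh_iff intro!: mesh_le_onD)
  show ?thesis
  proof (intro conjI block_jacobi_exists allI impI; elim conjE)
    fix W V assume "block_jacobi P c Ut W" "block_jacobi P c Uh V"
    then obtain Umax Umin where lims:
      "maximal_solution P Uh Ut Umax" "minimal_solution P Uh Ut Umin"
      "\<And>\<alpha> i j. (i, j) \<in> mesh P \<Longrightarrow> (\<lambda>n. W n \<alpha> i j) \<longlonglongrightarrow> Umax \<alpha> i j"
      "\<And>\<alpha> i j. (i, j) \<in> mesh P \<Longrightarrow> (\<lambda>n. V n \<alpha> i j) \<longlonglongrightarrow> Umin \<alpha> i j"
      and V_inc: "\<And>n. mesh_le_on (mesh P) (V n) (V (Suc n))"
      and order: "\<And>n. mesh_le_on (mesh P) (V n) Umin" "mesh_le_on (mesh P) Umin Umax"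
        "\<And>n. mesh_le_on (mesh P) Umax (W n)"
      and W_dec: "\<And>n. mesh_le_on (mesh P) (W (Suc n)) (W n)"
      by (rule monotone_convergence) (rule that; assumption)
    have pred: "mesh_le_on (mesh P) (V (n - 1)) (V n)" "mesh_le_on (mesh P) (W n) (W (n - 1))"
      if "n \<ge> 1" for n
      using V_inc[of "n - 1"] W_dec[of "n - 1"] that by simp_all
    show "\<exists>Umax Umin.
         maximal_solution P Uh Ut Umax \<and> minimal_solution P Uh Ut Umin \<and>
         (\<forall>\<alpha>. \<forall>(i, j)\<in>mesh P. (\<lambda>n. W n \<alpha> i j) \<longlonglongrightarrow> Umax \<alpha> i j) \<and>
         (\<forall>\<alpha>. \<forall>(i, j)\<in>mesh P. (\<lambda>n. V n \<alpha> i j) \<longlonglongrightarrow> Umin \<alpha> i j) \<and>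
         (\<forall>n\<ge>1. \<forall>i\<le>Nx P. \<forall>\<alpha>.
            line P (V (n - 1) \<alpha>) i \<le> line P (V n \<alpha>) i \<and>
            line P (V n \<alpha>) i \<le> line P (Umin \<alpha>) i \<and>
            line P (Umin \<alpha>) i \<le> line P (Umax \<alpha>) i \<and>
            line P (Umax \<alpha>) i \<le> line P (W n \<alpha>) i \<and>
            line P (W n \<alpha>) i \<le> line P (W (n - 1) \<alpha>) i) \<and>
         (\<forall>S\<in>sector P Uh Ut. scheme_solution P S \<longrightarrow>
            mesh_le_on (mesh P) Umin S \<and> mesh_le_on (mesh P) S Umax)"
    proof (rule exI[of _ Umax], rule exI[of _ Umin], intro conjI)
      show "\<forall>n\<ge>1. \<forall>i\<le>Nx P. \<forall>\<alpha>.
            line P (V (n - 1) \<alpha>) i \<le> line P (V n \<alpha>) i \<and>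
            line P (V n \<alpha>) i \<le> line P (Umin \<alpha>) i \<and>
            line P (Umin \<alpha>) i \<le> line P (Umax \<alpha>) i \<and>
            line P (Umax \<alpha>) i \<le> line P (W n \<alpha>) i \<and>
            line P (W n \<alpha>) i \<le> line P (W (n - 1) \<alpha>) i"
        using pred order by (auto intro: line_le)
    qed (use lims in \<open>auto simp: maximal_solution_def minimal_solution_def\<close>)
  qed
qed

end
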